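(* There exist constants $C_1>1$ and $\tau_2>0$, depending only on $r$ and $n$, such that for every $0<\varepsilon<\tau_2$ and every $\zeta\in b\Omega$, $$T^{flow}_\varepsilon(\zeta)\subseteq T_{C_1\varepsilon}(\zeta)\quad\text{and}\quad T_\varepsilon(\zeta)\subseteq T^{flow}_{C_1\varepsilon}(\zeta).$$ In particular, for every $Q\in\mathcal{D}$ with $\ell(Q)\le\tau_2/\mathfrak{C}$, $$T^{proj}_d(Q)\subseteq T^{flow}_{\mathfrak{C}C_1\ell(Q)}(c(Q))\quad\text{and}\quad T^{flow}_d(Q)\subseteq T_{\mathfrak{C}C_1\ell(Q)}(c(Q)).$$
   Context: Let $n\ge 2$ and let $\Omega\subset\mathbb{C}^n$ be a bounded convex domain with smooth boundary $b\Omega$ of finite type $M$ (i.e. $M<\infty$ is the supremum over $p\in b\Omega$ of the maximal order of contact at $p$ of $b\Omega$ with complex lines). Write $\Omega=\{z:r(z)<0\}$, where $r$ is a smooth, everywhere convex defining function with $\nabla r\neq 0$ on $b\Omega$, normalized so that $|\nabla r|=1$ on $b\Omega$ and $\tfrac23\le|\nabla r|\le\tfrac32$ on a fixed sufficiently small open neighborhood $U$ of $b\Omega$ on which the nearest-point projection $\Pi^{proj}:\Omega\cap U\to b\Omega$ is well defined. Normal gradient flow: let $V\subset U$ be an open neighborhood of $b\Omega$, $t_0>0$ small, and $\varphi:V\times[0,t_0)\to U\cap\overline{\Omega}$ the solution of $\frac{d}{dt}\varphi(x,t)=-\frac{\nabla r}{|\nabla r|^2}(\varphi(x,t))$, $\varphi(x,0)=x$;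 then $r(\varphi(x,t))=r(x)-t$ and $\varphi(\cdot,t)$ maps $b\Omega$ diffeomorphically onto $\{r=-t\}$. For $z\in V\cap\overline\Omega$ with $-r(z)<t_0$, $\Pi^{flow}(z)$ is the unique point of $b\Omega$ with $\varphi(\Pi^{flow}(z),-r(z))=z$. McNeal–Stein geometry: for $\xi$ near $b\Omega$, a unit vector $u\in\mathbb{C}^n$ and $\varepsilon>0$ let $\tau(\xi,u,\varepsilon)=\sup\{c>0:|r(\xi+\lambda u)-r(\xi)|\le\varepsilon\text{ for all }\lambda\in\mathbb{C},|\lambda|\le c\}$. The $\varepsilon$-extremal basis $u_1,\dots,u_n$ at $\xi$ is the orthonormal basis where $u_1$ is the unit vector in the direction of the gradient of $r$ at $\xi$ (pointing to the level set $\{r=r(\xi)+\varepsilon\}$), and inductively $u_k$ is a unit vector complex-orthogonal to $u_1,\dots,u_{k-1}$ maximizing the distance from $\xi$ to $\{r=r(\xi)+\varepsilon\}$ along the complex line $\xi+\mathbb{C}u$. Set $P_\varepsilon(\xi)=\{\xi+\sum_{k=1}^n\lambda_ku_k:\lambda_k\in\mathbb{C},|\lambda_k|\le\tau(\xi,u_k,\varepsilon)\}$, and on $b\Omega$ the quasi-metric $\rho(\zeta_1,\zeta_2)=\inf\{\varepsilon>0:\zeta_1\in P_\varepsilon(\zeta_2),\ \zeta_2\in P_\varepsilon(\zeta_1)\}$ with balls $B(\zeta,\varepsilon)=\{\eta\in b\Omega:\rho(\eta,\zeta)<\varepsilon\}=P_\varepsilon(\zeta)\cap b\Omega$. Tents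 over McNeal–Stein balls: for $\zeta\in b\Omega$, $\varepsilon>0$, $T_\varepsilon(\zeta)=\{z\in\Omega:\Pi^{proj}(z)\in P_\varepsilon(\zeta)\cap b\Omega,\ r(z)\in(-\varepsilon,0)\}$ and $T^{flow}_\varepsilon(\zeta)=\{z\in\Omega:\Pi^{flow}(z)\in P_\varepsilon(\zeta)\cap b\Omega,\ r(z)\in(-\varepsilon,0)\}$. Dyadic system: $\mathcal{D}=\bigcup_k\mathcal{D}_k$ is a family of Borel subsets of $b\Omega$ ("cubes") with constants $\mathfrak{C}>1$, $0<\delta,\epsilon<1$ and points $c(Q)\in b\Omega$ such that each $\mathcal{D}_k$ is a partition of $b\Omega$; any two cubes are either nested or disjoint; each $Q\in\mathcal{D}_k$ contains at least one cube of $\mathcal{D}_{k+1}$ and is contained in exactly one cube of $\mathcal{D}_{k-1}$; $\sigma(Q')\ge\epsilon\sigma(Q)$ whenever $Q'$ is a child of $Q$ ($\sigma$ surface measure); and $B(c(Q),\delta^k)\subset Q\subset B(c(Q),\mathfrak{C}\delta^k)$ for $Q\in\mathcal{D}_k$. The side length is $\ell(Q)=\delta^k$ for $Q\in\mathcal{D}_k$. Dyadic tents (for $\ell(Q)$ small): $T^{proj}_d(Q)=\{z\in\Omega\cap U:\Pi^{proj}(z)\in Q,\ r(z)\in(-\ell(Q),0)\}$ and $T^{flow}_d(Q)=\{z\in V:\Pi^{flow}(z)\in Q,\ r(z)\in(-\ell(Q),0)\}$. *)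

theory Defs
  imports "HOL-Analysis.Analysis" "HOL-Library.Landau_Symbols" "HOL-Library.Extended_Nat"
begin

coinductive smooth_fun :: "('a::euclidean_space \<Rightarrow> real) \<Rightarrow> bool" where
  "f differentiable_on UNIV \<Longrightarrow> (\<forall>v. smooth_fun (\<lambda>x. frechet_derivative f (at x) v))
     \<Longrightarrow> smooth_fun f"

text \<open>Real gradient of r at x (C^n viewed as R^{2n} with the real inner product).\<close>
definition grad :: "('a::euclidean_space \<Rightarrow> real) \<Rightarrow> 'a \<Rightarrow> 'a" where
  "grad r x = (SOME g. (r has_derivative (\<lambda>h. g \<bullet> h)) (at x))"

definition Omega :: "(complex^'n \<Rightarrow> real) \<Rightarrow> (complex^'n) set" where
  "Omega r = {z. r z < 0}"

definition bdry :: "(complex^'n \<Rightarrow> real) \<Rightarrow> (complex^'n) set" where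
  "bdry r = frontier (Omega r)"

definition contact_order :: "(complex^'n \<Rightarrow> real) \<Rightarrow> complex^'n \<Rightarrow> complex^'n \<Rightarrow> enat" where
  "contact_order r p v =
     Sup (enat ` {m. (\<lambda>l::complex. r (p + l *s v)) \<in> O[at 0](\<lambda>l. cmod l ^ m)})"

definition finite_type :: "(complex^'n \<Rightarrow> real) \<Rightarrow> bool" where
  "finite_type r \<longleftrightarrow> (SUP p\<in>bdry r. SUP v\<in>{v. v \<noteq> 0}. contact_order r p v) < \<infinity>"

definition admissible_defining_function :: "(complex^'n \<Rightarrow> real) \<Rightarrow> bool" where
  "admissible_defining_function r \<longleftrightarrow>
     CARD('n) \<ge> 2 \<and> smooth_fun r \<and> convex_on UNIV r \<and>
     Omega r \<noteq> {} \<and> bounded (Omega r) \<and> connected (Omega r) \<and>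
     (\<forall>z\<in>bdry r. grad r z \<noteq> 0 \<and> norm (grad r z) = 1) \<and>
     finite_type r"

definition admissible_nbhd :: "(complex^'n \<Rightarrow> real) \<Rightarrow> (complex^'n) set \<Rightarrow> bool" where
  "admissible_nbhd r U \<longleftrightarrow> open U \<and> bdry r \<subseteq> U \<and>
     (\<forall>z\<in>U. 2/3 \<le> norm (grad r z) \<and> norm (grad r z) \<le> 3/2) \<and>
     (\<forall>z\<in>Omega r \<inter> U. \<exists>!p. p \<in> bdry r \<and> dist z p = infdist z (bdry r))"

definition proj :: "(complex^'n \<Rightarrow> real) \<Rightarrow> complex^'n \<Rightarrow> complex^'n" where
  "proj r z = (THE p. p \<in> bdry r \<and> dist z p = infdist z (bdry r))"

definition admissible_flow ::
  "(complex^'n \<Rightarrow> real) \<Rightarrow> (complex^'n) set \<Rightarrow> (complex^'n) set \<Rightarrow> real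
     \<Rightarrow> ((complex^'n) \<times> real \<Rightarrow> complex^'n) \<Rightarrow> bool" where
  "admissible_flow r U V t0 \<phi> \<longleftrightarrow>
     open V \<and> V \<subseteq> U \<and> bdry r \<subseteq> V \<and> t0 > 0 \<and>
     (\<forall>x\<in>V. \<phi> (x, 0) = x \<and>
        (\<forall>t\<in>{0..<t0}. \<phi> (x, t) \<in> U \<and>
           ((\<lambda>s. \<phi> (x, s)) has_vector_derivative
              (- (1 / (norm (grad r (\<phi> (x, t))))\<^sup>2) *\<^sub>R grad r (\<phi> (x, t))))
             (at t within {0..<t0}))) \<and>
     (\<forall>x\<in>V. \<forall>t\<in>{0..<t0}. r (\<phi> (x, t)) = r x - t) \<and>
     (\<forall>t\<in>{0..<t0}. bij_betw (\<lambda>x. \<phi> (x, t)) (bdry r) {z. r z = - t})"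

definition flowproj ::
  "(complex^'n \<Rightarrow> real) \<Rightarrow> ((complex^'n) \<times> real \<Rightarrow> complex^'n) \<Rightarrow> complex^'n \<Rightarrow> complex^'n" where
  "flowproj r \<phi> z = (THE p. p \<in> bdry r \<and> \<phi> (p, - r z) = z)"

definition tau :: "(complex^'n \<Rightarrow> real) \<Rightarrow> complex^'n \<Rightarrow> complex^'n \<Rightarrow> real \<Rightarrow> real" where
  "tau r \<xi> u \<epsilon> = Sup {c. c > 0 \<and> (\<forall>l::complex. cmod l \<le> c \<longrightarrow> \<bar>r (\<xi> + l *s u) - r \<xi>\<bar> \<le> \<epsilon>)}"

definition cinner :: "complex^'n \<Rightarrow> complex^'n \<Rightarrow> complex" where
  "cinner u v = (\<Sum>i\<in>UNIV. u $ i * cnj (v $ i))"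

definition linedist :: "(complex^'n \<Rightarrow> real) \<Rightarrow> complex^'n \<Rightarrow> complex^'n \<Rightarrow> real \<Rightarrow> real" where
  "linedist r \<xi> u \<epsilon> = Inf {cmod l | l. r (\<xi> + l *s u) = r \<xi> + \<epsilon>}"

definition extremal_basis ::
  "(complex^'n \<Rightarrow> real) \<Rightarrow> complex^'n \<Rightarrow> real \<Rightarrow> (nat \<Rightarrow> complex^'n) \<Rightarrow> bool" where
  "extremal_basis r \<xi> \<epsilon> b \<longleftrightarrow>
     b 0 = (1 / norm (grad r \<xi>)) *\<^sub>R grad r \<xi> \<and>
     (\<forall>k\<in>{1..<CARD('n)}.
        norm (b k) = 1 \<and> (\<forall>j<k. cinner (b k) (b j) = 0) \<and>
        (\<forall>u. norm u = 1 \<and> (\<forall>j<k. cinner u (b j) = 0) \<longrightarrow>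
              linedist r \<xi> u \<epsilon> \<le> linedist r \<xi> (b k) \<epsilon>))"

definition ext_basis :: "(complex^'n \<Rightarrow> real) \<Rightarrow> complex^'n \<Rightarrow> real \<Rightarrow> nat \<Rightarrow> complex^'n" where
  "ext_basis r \<xi> \<epsilon> = (SOME b. extremal_basis r \<xi> \<epsilon> b)"

definition polydisc :: "(complex^'n \<Rightarrow> real) \<Rightarrow> real \<Rightarrow> complex^'n \<Rightarrow> (complex^'n) set" where
  "polydisc r \<epsilon> \<xi> =
     {\<xi> + (\<Sum>k<CARD('n). lam k *s ext_basis r \<xi> \<epsilon> k) | lam.
        \<forall>k<CARD('n). cmod (lam k) \<le> tau r \<xi> (ext_basis r \<xi> \<epsilon> k) \<epsilon>}"

definition MSball :: "(complex^'n \<Rightarrow> real) \<Rightarrow> complex^'n \<Rightarrow> real \<Rightarrow> (complex^'n) set" where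
  "MSball r \<zeta> \<epsilon> = polydisc r \<epsilon> \<zeta> \<inter> bdry r"

definition tent :: "(complex^'n \<Rightarrow> real) \<Rightarrow> (complex^'n) set \<Rightarrow> real \<Rightarrow> complex^'n \<Rightarrow> (complex^'n) set" where
  "tent r U \<epsilon> \<zeta> = {z \<in> Omega r \<inter> U. proj r z \<in> polydisc r \<epsilon> \<zeta> \<inter> bdry r \<and> - \<epsilon> < r z \<and> r z < 0}"

definition tent_flow ::
  "(complex^'n \<Rightarrow> real) \<Rightarrow> (complex^'n) set \<Rightarrow> ((complex^'n) \<times> real \<Rightarrow> complex^'n)
     \<Rightarrow> real \<Rightarrow> complex^'n \<Rightarrow> (complex^'n) set" where
  "tent_flow r V \<phi> \<epsilon> \<zeta> = {z \<in> Omega r \<inter> V. flowproj r \<phi> z \<in> polydisc r \<epsilon> \<zeta> \<inter> bdry r \<and> - \<epsilon> < r z \<and> r z < 0}"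

definition dyadic_system ::
  "(complex^'n \<Rightarrow> real) \<Rightarrow> (nat \<Rightarrow> (complex^'n) set set) \<Rightarrow> ((complex^'n) set \<Rightarrow> complex^'n)
     \<Rightarrow> real \<Rightarrow> real \<Rightarrow> bool" where
  "dyadic_system r D c Cf \<delta> \<longleftrightarrow>
     Cf > 1 \<and> 0 < \<delta> \<and> \<delta> < 1 \<and>
     (\<forall>k. D k \<subseteq> sets borel \<and> \<Union>(D k) = bdry r \<and> {} \<notin> D k \<and>
          (\<forall>Q\<in>D k. \<forall>Q'\<in>D k. Q \<noteq> Q' \<longrightarrow> Q \<inter> Q' = {})) \<and>
     (\<forall>k m. \<forall>Q\<in>D k. \<forall>Q'\<in>D m. Q \<subseteq> Q' \<or> Q' \<subseteq> Q \<or> Q \<inter> Q' = {}) \<and>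
     (\<forall>k. \<forall>Q\<in>D k. \<exists>Q'\<in>D (Suc k). Q' \<subseteq> Q) \<and>
     (\<forall>k. \<forall>Q\<in>D (Suc k). \<exists>!Q'\<in>D k. Q \<subseteq> Q') \<and>
     (\<forall>k. \<forall>Q\<in>D k. c Q \<in> bdry r \<and> MSball r (c Q) (\<delta> ^ k) \<subseteq> Q \<and> Q \<subseteq> MSball r (c Q) (Cf * \<delta> ^ k))"

definition tent_d_proj :: "(complex^'n \<Rightarrow> real) \<Rightarrow> (complex^'n) set \<Rightarrow> (complex^'n) set \<Rightarrow> real \<Rightarrow> (complex^'n) set" where
  "tent_d_proj r U Q l = {z \<in> Omega r \<inter> U. proj r z \<in> Q \<and> - l < r z \<and> r z < 0}"

definition tent_d_flow ::
  "(complex^'n \<Rightarrow> real) \<Rightarrow> (complex^'n) set \<Rightarrow> ((complex^'n) \<times> real \<Rightarrow> complex^'n)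
     \<Rightarrow> (complex^'n) set \<Rightarrow> real \<Rightarrow> (complex^'n) set" where
  "tent_d_flow r V \<phi> Q l = {z \<in> V. flowproj r \<phi> z \<in> Q \<and> - l < r z \<and> r z < 0}"

end

(*
  The body S(e) of all h with r(\<zeta> + l h) - r(\<zeta>) <= e for every complex l in the unit disc is
  convex and invariant under multiplication by l. In every complex direction its radius is tau,
  and by convexity this is also the distance that defines the extremal basis; hence
  P(e) - \<zeta> lies in n S(e), and S(e) in a fixed multiple of P(e) - \<zeta>. Finite type and compactness
  bound some coefficient of order <= M of r along each complex line from below, so r behaves
  like a nonzero polynomial there and B S(e) lies in S(C e) for small e. Points of P(e) therefore
  stay in P(C e) when moved by O(e), and the two projections of z differ by O(-r(z)): the flow
  moves with speed at most 3/2, and the nearest point is no further away than the flow point.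
*)
theory Submission
  imports Defs
begin

section \<open>Iterated directional derivatives\<close>

text \<open>The extremal basis depends on the scale, so the polydiscs at e and C e have unrelated
  axes and cannot be compared coordinate by coordinate; the basis-free body S is what passes between
  scales. Convexity gives only one half of the scaling, S(C e) inside C S(e). The reverse half fails
  for functions as flat as exp(-1/t), and this is where finite type enters. Finite type bounds the
  jet from below along at least one, unspecified, real direction of each complex line, whereas
  doubling concerns all directions. The lower bound is therefore spent only on the length s of
  vectors in S(e), giving s^M = O(e); Taylor remainders of order M + 1 are then O(e) in every
  direction, and the lower coefficients are controlled in each direction by membership in S(e)
  itself. The first basis vector is the gradient and not a direction of maximal tau, so its
  coordinate is bounded separately, by the tangent inequality and the Lipschitz bound.\<close>

primrec dirder :: "nat \<Rightarrow> ('a::euclidean_space \<Rightarrow> real) \<Rightarrow> 'a \<Rightarrow> 'a \<Rightarrow> real" where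
  "dirder 0 f v = f"
| "dirder (Suc j) f v = dirder j (\<lambda>x. frechet_derivative f (at x) v) v"

lemma smooth_fun_differentiable: "smooth_fun f \<Longrightarrow> f differentiable (at x)"
  by (erule smooth_fun.cases) (auto simp: differentiable_on_def)

lemma smooth_fun_frechet: "smooth_fun f \<Longrightarrow> smooth_fun (\<lambda>x. frechet_derivative f (at x) v)"
  by (erule smooth_fun.cases) auto

lemma smooth_fun_has_derivative:
  "smooth_fun f \<Longrightarrow> (f has_derivative frechet_derivative f (at x)) (at x)"
  using smooth_fun_differentiable frechet_derivative_works by blast

lemma smooth_fun_continuous: "smooth_fun f \<Longrightarrow> continuous_on A f"
  by (meson smooth_fun_has_derivative has_derivative_at_withinI has_derivative_continuous_on)

lemma smooth_fun_dirder: "smooth_fun f \<Longrightarrow> smooth_fun (dirder j f v)"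
  by (induction j arbitrary: f) (auto intro: smooth_fun_frechet)

text \<open>The defining recursion differentiates innermost, which suits induction over all smooth
  functions; differentiating along a line needs the outermost form.\<close>

lemma dirder_Suc': "dirder (Suc j) f v = (\<lambda>x. frechet_derivative (dirder j f v) (at x) v)"
  by (induction j arbitrary: f) auto

lemma has_real_derivative_dirder:
  assumes "smooth_fun f"
  shows "((\<lambda>t. dirder j f v (x + t *\<^sub>R v)) has_real_derivative dirder (Suc j) f v (x + t *\<^sub>R v)) (at t)"
proof -
  let ?g = "dirder j f v"
  have "(?g has_derivative frechet_derivative ?g (at (x + t *\<^sub>R v))) (at (x + t *\<^sub>R v))"
    using smooth_fun_has_derivative smooth_fun_dirder assms by blast
  then have "((\<lambda>t. ?g (x + t *\<^sub>R v)) has_derivative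
      (\<lambda>s. frechet_derivative ?g (at (x + t *\<^sub>R v)) (s *\<^sub>R v))) (at t)"
    by (rule has_derivative_compose[rotated]) (auto intro!: derivative_eq_intros)
  moreover have "linear (frechet_derivative ?g (at (x + t *\<^sub>R v)))"
    using smooth_fun_differentiable[OF smooth_fun_dirder[OF assms]] linear_frechet_derivative by blast
  ultimately show ?thesis
    unfolding has_field_derivative_def dirder_Suc' by (simp add: linear_cmul mult.commute[of _ "frechet_derivative _ _ _"])
qed

lemma dirder_sum:
  assumes "finite B" "\<And>b. b \<in> B \<Longrightarrow> smooth_fun (g b)"
  shows "dirder j (\<lambda>x. \<Sum>b\<in>B. c b * g b x) v x = (\<Sum>b\<in>B. c b * dirder j (g b) v x)"
  using assms(2)
proof (induction j arbitrary: g)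
  case (Suc j)
  have "((\<lambda>x. \<Sum>b\<in>B. c b * g b x) has_derivative
      (\<lambda>h. \<Sum>b\<in>B. c b * frechet_derivative (g b) (at x) h)) (at x)" for x
    using Suc.prems
    by (auto intro!: has_derivative_sum has_derivative_mult_right smooth_fun_has_derivative)
  then have "(\<lambda>x. frechet_derivative (\<lambda>x. \<Sum>b\<in>B. c b * g b x) (at x) v)
      = (\<lambda>x. \<Sum>b\<in>B. c b * frechet_derivative (g b) (at x) v)"
    by (metis (no_types, lifting) frechet_derivative_at)
  then show ?case
    using Suc.IH[of "\<lambda>b x. frechet_derivative (g b) (at x) v"] Suc.prems
    by (auto intro: smooth_fun_frechet)
qed auto

text \<open>Joint continuity in point and direction is what compactness arguments over
  \<open>bdry r\<close> times the unit sphere require. The first derivative is linear in v, and for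
  fixed v its coefficients \<open>v \<bullet> b\<close> are constants in x, so they pass through the
  remaining derivatives and the induction applies to the partial derivatives.\<close>

lemma continuous_on_dirder:
  assumes "smooth_fun f"
  shows "continuous_on UNIV (\<lambda>(x, v). dirder j f v x)"
  using assms
proof (induction j arbitrary: f)
  case 0
  then show ?case
    using continuous_on_compose2[OF smooth_fun_continuous[of f UNIV] continuous_on_fst[OF continuous_on_id]]
    by (simp add: case_prod_beta')
next
  case (Suc j)
  have lin: "linear (frechet_derivative f (at x))" for x
    using smooth_fun_differentiable[OF Suc.prems] linear_frechet_derivative by blast
  have "frechet_derivative f (at x) v = (\<Sum>b\<in>Basis. (v \<bullet> b) * frechet_derivative f (at x) b)" for x v
    by (subst euclidean_representation[of v, symmetric])
      (simp add: linear_sum[OF lin] linear_cmul[OF lin])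
  then have eq: "(\<lambda>x. frechet_derivative f (at x) v)
      = (\<lambda>x. \<Sum>b\<in>Basis. (v \<bullet> b) * frechet_derivative f (at x) b)" for v
    by (rule ext)
  have "dirder (Suc j) f v x
      = (\<Sum>b\<in>Basis. (v \<bullet> b) * dirder j (\<lambda>x. frechet_derivative f (at x) b) v x)" for x v
    unfolding dirder.simps(2) eq[of v]
    by (rule dirder_sum) (simp_all add: smooth_fun_frechet Suc.prems)
  then have eq: "(\<lambda>(x, v). dirder (Suc j) f v x) = (\<lambda>p. \<Sum>b\<in>Basis. (snd p \<bullet> b)
       * (\<lambda>(x, v). dirder j (\<lambda>x. frechet_derivative f (at x) b) v x) p)"
    by (auto simp: fun_eq_iff)
  show ?case
    unfolding eq
    by (intro continuous_intros Suc.IH smooth_fun_frechet Suc.prems)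
qed

lemma Maclaurin_dirder:
  assumes "smooth_fun f"
  shows "\<exists>s. \<bar>s\<bar> \<le> \<bar>t\<bar> \<and> f (x + t *\<^sub>R v)
     = (\<Sum>j<n. dirder j f v x / fact j * t ^ j) + dirder n f v (x + s *\<^sub>R v) / fact n * t ^ n"
  using Maclaurin_all_le[of "\<lambda>j t. dirder j f v (x + t *\<^sub>R v)" "\<lambda>t. f (x + t *\<^sub>R v)" t n]
    has_real_derivative_dirder[OF assms] by auto

text \<open>Equivalence of norms on polynomials of degree at most n, in scale-invariant form: C
  depends on n alone and serves intervals of every length s.\<close>

lemma sum_abs_coeff_le:
  shows "\<exists>C>0. \<forall>a :: nat \<Rightarrow> real. \<forall>s e. 0 \<le> s \<and> (\<forall>t\<in>{0..s}. \<bar>\<Sum>j\<le>n. a j * t ^ j\<bar> \<le> e)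
      \<longrightarrow> (\<Sum>j\<le>n. \<bar>a j\<bar> * s ^ j) \<le> C * e"
proof (induction n)
  case 0
  show ?case
    by (rule exI[of _ 1]) auto
next
  case (Suc n)
  then obtain C where C: "C > 0" and IH:
    "\<And>(a :: nat \<Rightarrow> real) s e. 0 \<le> s \<Longrightarrow> (\<And>t. t\<in>{0..s} \<Longrightarrow> \<bar>\<Sum>j\<le>n. a j * t ^ j\<bar> \<le> e)
      \<Longrightarrow> (\<Sum>j\<le>n. \<bar>a j\<bar> * s ^ j) \<le> C * e"
    by metis
  define K where "K = C * (1 + 2 ^ Suc n)"
  have "(\<Sum>j\<le>Suc n. \<bar>a j\<bar> * s ^ j) \<le> (1 + 2 * K) * e"
    if s: "0 \<le> s" and P: "\<And>t. t\<in>{0..s} \<Longrightarrow> \<bar>\<Sum>j\<le>Suc n. a j * t ^ j\<bar> \<le> e" for a :: "nat \<Rightarrow> real" and s e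
  proof -
    \<comment> \<open>Passing from \<open>P t\<close> to \<open>P t - 2 ^ Suc n * P (t / 2)\<close> removes the leading term and
      does not decrease the other coefficients.\<close>
    define b where "b j = a j * (1 - 2 ^ Suc n / 2 ^ j)" for j
    have "\<bar>\<Sum>j\<le>n. b j * t ^ j\<bar> \<le> (1 + 2 ^ Suc n) * e" if t: "t \<in> {0..s}" for t
    proof -
      have "(\<Sum>j\<le>n. b j * t ^ j)
          = (\<Sum>j\<le>Suc n. a j * t ^ j) - 2 ^ Suc n * (\<Sum>j\<le>Suc n. a j * (t / 2) ^ j)"
        unfolding sum_distrib_left sum_subtractf[symmetric]
        by (simp add: b_def power_divide right_diff_distrib left_diff_distrib mult_ac)
      moreover have "\<bar>2 ^ Suc n * (\<Sum>j\<le>Suc n. a j * (t / 2) ^ j)\<bar> \<le> 2 ^ Suc n * e"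
        unfolding abs_mult using P[of "t/2"] t by (intro mult_mono) auto
      ultimately show ?thesis
        using P[OF t] unfolding distrib_right by linarith
    qed
    from IH[OF s this] have "(\<Sum>j\<le>n. \<bar>b j\<bar> * s ^ j) \<le> K * e"
      by (simp add: K_def)
    moreover have "(\<Sum>j\<le>n. \<bar>a j\<bar> * s ^ j) \<le> (\<Sum>j\<le>n. \<bar>b j\<bar> * s ^ j)"
    proof (intro sum_mono mult_right_mono)
      fix j assume "j \<in> {..n}"
      then have "2 * (2::real) ^ j \<le> 2 ^ Suc n"
        by (simp add: power_increasing)
      then have "2 \<le> 2 ^ Suc n / (2::real) ^ j"
        by (subst pos_le_divide_eq) simp_all
      then have "1 \<le> \<bar>1 - 2 ^ Suc n / 2 ^ j :: real\<bar>"
        by linarith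
      then show "\<bar>a j\<bar> \<le> \<bar>b j\<bar>"
        unfolding b_def abs_mult using mult_left_mono[of 1 _ "\<bar>a j\<bar>"] by simp
    qed (use s in auto)
    ultimately have low: "(\<Sum>j\<le>n. \<bar>a j\<bar> * s ^ j) \<le> K * e" by simp
    have "\<bar>a (Suc n)\<bar> * s ^ Suc n = \<bar>(\<Sum>j\<le>Suc n. a j * s ^ j) - (\<Sum>j\<le>n. a j * s ^ j)\<bar>"
      using s by (simp add: abs_mult)
    also have "\<dots> \<le> e + (\<Sum>j\<le>n. \<bar>a j * s ^ j\<bar>)"
      using P[of s] s sum_abs[of "\<lambda>j. a j * s ^ j" "{..n}"] unfolding atLeastAtMost_iff by linarith
    also have "(\<Sum>j\<le>n. \<bar>a j * s ^ j\<bar>) = (\<Sum>j\<le>n. \<bar>a j\<bar> * s ^ j)"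
      using s by (simp add: abs_mult)
    finally have "\<bar>a (Suc n)\<bar> * s ^ Suc n \<le> e + K * e"
      using low by simp
    with low show ?thesis
      unfolding sum.atMost_Suc distrib_right by simp
  qed
  moreover have "1 + 2 * K > 0"
    using C by (simp add: K_def add_pos_pos)
  ultimately show ?case
    by (intro exI[of _ "1 + 2 * K"]) simp
qed

section \<open>Extremal bases of convex functions\<close>

lemma norm_vector_smult: "norm (c *s v) = cmod c * norm (v :: complex^'n)"
  by (simp add: norm_vec_def norm_mult L2_set_right_distrib)

lemma of_real_vector_smult: "of_real c *s (v :: complex^'n) = c *\<^sub>R v"
  by (simp add: vec_eq_iff scaleR_conv_of_real[where 'a = complex])

lemma vector_smult_scaleR: "l *s (c *\<^sub>R (v :: complex^'n)) = (l * of_real c) *s v"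
  by (simp add: of_real_vector_smult[symmetric] vector_smult_assoc)

lemma continuous_on_vector_smult [continuous_intros]:
  assumes "continuous_on A c"
  shows "continuous_on A (\<lambda>x. c x *s (v :: complex^'n))"
  unfolding vector_scalar_mult_def using assms by (intro continuous_intros)

lemma continuous_on_vector_smult_right [continuous_intros]:
  assumes "continuous_on A f"
  shows "continuous_on A (\<lambda>x. c *s (f x :: complex^'n))"
  unfolding vector_scalar_mult_def using assms by (intro continuous_intros)

lemma cinner_add_left: "cinner (u + v) w = cinner u w + cinner v w"
  by (simp add: cinner_def distrib_right sum.distrib)

lemma cinner_diff_left: "cinner (u - v) w = cinner u w - cinner v w"
  by (simp add: cinner_def left_diff_distrib sum_subtractf)

lemma cinner_smult_left: "cinner (c *s u) w = c * cinner u w"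
  by (simp add: cinner_def sum_distrib_left mult_ac)

lemma cinner_scaleR_left: "cinner (c *\<^sub>R u) w = of_real c * cinner u w"
  using cinner_smult_left[of "of_real c" u w] by (simp add: of_real_vector_smult)

lemma cinner_zero_left [simp]: "cinner 0 w = 0"
  by (simp add: cinner_def)

lemma cinner_sum_left: "cinner (\<Sum>j\<in>J. f j) w = (\<Sum>j\<in>J. cinner (f j) w)"
  by (induction J rule: infinite_finite_induct) (auto simp: cinner_add_left)

lemma Re_cinner: "Re (cinner u v) = u \<bullet> v"
  by (simp add: cinner_def inner_vec_def inner_complex_def)

lemma Im_cinner: "Im (cinner u v) = u \<bullet> (\<i> *s v)"
  by (simp add: cinner_def inner_vec_def inner_complex_def algebra_simps)

lemma cnj_cinner: "cnj (cinner u v) = cinner v u"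
  by (simp add: cinner_def mult.commute)

lemma cinner_self: "cinner u u = of_real ((norm u)\<^sup>2)"
proof (rule complex_eqI)
  have "Im (cinner u u) = 0"
    using cnj_cinner[of u u] by (metis complex_cnj_cancel_iff complex_is_Real_iff Reals_cnj_iff)
  then show "Im (cinner u u) = Im (of_real ((norm u)\<^sup>2))" by simp
qed (simp add: Re_cinner power2_norm_eq_inner)

lemma ex_unimodular_mult: "\<exists>c. cmod c = 1 \<and> c * z = of_real (cmod z)"
proof (cases "z = 0")
  case False
  show ?thesis
  proof (intro exI conjI)
    show "cmod (cnj z / of_real (cmod z)) = 1"
      using False by (simp add: norm_divide)
    show "cnj z / of_real (cmod z) * z = of_real (cmod z)"
      using False complex_norm_square[of z] by (simp add: field_simps power2_eq_square)
  qed
qed (auto intro: exI[of _ 1])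

lemma ex_unimodular_inner: "\<exists>c. cmod c = 1 \<and> (c *s u) \<bullet> v = cmod (cinner u v)"
proof -
  obtain c where "cmod c = 1" "c * cinner u v = of_real (cmod (cinner u v))"
    using ex_unimodular_mult by blast
  then show ?thesis
    by (metis Re_cinner Re_complex_of_real cinner_smult_left)
qed

lemma cmod_cinner_le: "cmod (cinner u v) \<le> norm u * norm v"
proof -
  obtain c where "cmod c = 1" "(c *s u) \<bullet> v = cmod (cinner u v)"
    using ex_unimodular_inner by blast
  then show ?thesis
    using norm_cauchy_schwarz[of "c *s u" v] by (simp add: norm_vector_smult)
qed

lemma continuous_on_cinner_left: "continuous_on A (\<lambda>u. cinner u v)"
  unfolding cinner_def by (intro continuous_intros)

text \<open>Complex orthogonality to k vectors amounts to real orthogonality to the 2k vectors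
  \<open>b j\<close> and \<open>\<i> *s b j\<close>, fewer than the real dimension.\<close>

lemma ex_nonzero_cinner_orthogonal:
  fixes b :: "nat \<Rightarrow> complex^'n"
  assumes "k < CARD('n)"
  shows "\<exists>u. u \<noteq> 0 \<and> (\<forall>j<k. cinner u (b j) = 0)"
proof -
  let ?S = "b ` {..<k} \<union> (\<lambda>j. \<i> *s b j) ` {..<k}"
  have "dim ?S \<le> card ?S" by (rule dim_le_card') simp
  also have "\<dots> \<le> k + k"
    by (rule order.trans[OF card_Un_le] add_mono)+
       (use card_image_le[of "{..<k}"] in \<open>auto intro: order.trans\<close>)
  also have "\<dots> < DIM(complex^'n)"
    using assms by simp
  finally obtain x where "x \<noteq> 0" and x: "\<And>y. y \<in> span ?S \<Longrightarrow> orthogonal x y"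
    using orthogonal_to_subspace_exists by blast
  moreover have "cinner x (b j) = 0" if "j < k" for j
    using that x[OF span_base, of "b j"] x[OF span_base, of "\<i> *s b j"]
    by (intro complex_eqI) (auto simp: Re_cinner Im_cinner orthogonal_def)
  ultimately show ?thesis by blast
qed

text \<open>Orthonormality says that the matrix with rows b, times its conjugate transpose, is the
  identity. A one-sided inverse of a square matrix is two-sided, and the product in the other order
  is the expansion. The bijection f translates between natural-number indices and the index type of
  the matrices.\<close>

lemma orthonormal_expansion:
  fixes b :: "nat \<Rightarrow> complex^'n"
  assumes norm: "\<And>k. k < CARD('n) \<Longrightarrow> norm (b k) = 1"
    and orth: "\<And>j k. k < CARD('n) \<Longrightarrow> j < k \<Longrightarrow> cinner (b k) (b j) = 0"
  shows "(\<Sum>k<CARD('n). cinner h (b k) *s b k) = h"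
proof -
  obtain f :: "'n \<Rightarrow> nat" where f: "bij_betw f UNIV {..<CARD('n)}"
    using ex_bij_betw_finite_nat[of "UNIV :: 'n set"] by (auto simp: atLeast0LessThan)
  have lt: "f i < CARD('n)" for i
    using f by (auto simp: bij_betw_def)
  have inj: "f i = f j \<longleftrightarrow> i = j" for i j
    using f by (auto simp: bij_betw_def inj_on_def)
  define A :: "complex^'n^'n" where "A = (\<chi> i. b (f i))"
  define B :: "complex^'n^'n" where "B = (\<chi> i j. cnj (b (f j) $ i))"
  have "cinner (b (f i)) (b (f j)) = (if i = j then 1 else 0)" for i j
  proof (cases "f i" "f j" rule: linorder_cases)
    case less
    have "cnj (cinner (b (f j)) (b (f i))) = 0" using orth[OF lt less] by simp
    then show ?thesis using less inj by (auto simp: cnj_cinner)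
  next
    case equal
    then show ?thesis using inj[of i j] by (simp add: cinner_self norm lt)
  next
    case greater
    then show ?thesis using orth[OF lt greater] by auto
  qed
  then have "A ** B = mat 1"
    by (simp add: vec_eq_iff matrix_matrix_mult_def A_def B_def mat_def cinner_def)
  then have BA: "B ** A = mat 1"
    by (rule matrix_left_right_inverse1)
  show ?thesis
    unfolding vec_eq_iff
  proof
    fix m
    have "(\<Sum>k<CARD('n). cinner h (b k) *s b k) = (\<Sum>i\<in>UNIV. cinner h (b (f i)) *s b (f i))"
      using sum.reindex_bij_betw[OF f, of "\<lambda>k. cinner h (b k) *s b k"] by simp
    then have "(\<Sum>k<CARD('n). cinner h (b k) *s b k) $ m
        = (\<Sum>i\<in>UNIV. \<Sum>j\<in>UNIV. h $ j * (B $ j $ i * A $ i $ m))"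
      by (simp add: cinner_def A_def B_def sum_distrib_left sum_distrib_right mult_ac)
    also have "\<dots> = (\<Sum>j\<in>UNIV. h $ j * (B ** A) $ j $ m)"
      by (subst sum.swap) (simp add: matrix_matrix_mult_def sum_distrib_left)
    also have "\<dots> = h $ m"
      by (simp add: BA mat_def if_distrib cong: if_cong)
    finally show "(\<Sum>k<CARD('n). cinner h (b k) *s b k) $ m = h $ m" .
  qed
qed

section \<open>Gradients and disc bodies of convex functions\<close>

lemma smooth_fun_grad:
  assumes "smooth_fun f"
  shows "(f has_derivative (\<lambda>h. grad f x \<bullet> h)) (at x)"
proof -
  let ?D = "frechet_derivative f (at x)"
  have "linear ?D"
    using smooth_fun_differentiable[OF assms] linear_frechet_derivative by blast
  \<comment> \<open>Riesz representation: \<open>adjoint ?D 1\<close> is a witness for the choice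
    made in \<open>grad\<close>.\<close>
  then have "?D = (\<lambda>h. adjoint ?D 1 \<bullet> h)"
    using adjoint_works[of ?D _ 1] by (auto simp: inner_commute)
  then have "(f has_derivative (\<lambda>h. adjoint ?D 1 \<bullet> h)) (at x)"
    using smooth_fun_has_derivative[OF assms, of x] by simp
  then show ?thesis
    unfolding grad_def by (rule someI)
qed

text \<open>Only an upper bound is imposed, which makes the body an intersection of sublevel sets
  and hence convex; the two-sided bound in \<open>tau\<close> is recovered by symmetry.\<close>

definition disc_body :: "(complex^'n \<Rightarrow> real) \<Rightarrow> complex^'n \<Rightarrow> real \<Rightarrow> (complex^'n) set" where
  "disc_body r \<xi> \<epsilon> = {h. \<forall>l. cmod l \<le> 1 \<longrightarrow> r (\<xi> + l *s h) - r \<xi> \<le> \<epsilon>}"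

lemma disc_bodyD: "h \<in> disc_body r \<xi> \<epsilon> \<Longrightarrow> cmod l \<le> 1 \<Longrightarrow> r (\<xi> + l *s h) - r \<xi> \<le> \<epsilon>"
  by (simp add: disc_body_def)

lemma disc_body_smult: "h \<in> disc_body r \<xi> \<epsilon> \<Longrightarrow> cmod c \<le> 1 \<Longrightarrow> c *s h \<in> disc_body r \<xi> \<epsilon>"
  by (auto simp: disc_body_def vector_smult_assoc norm_mult mult_le_one)

lemma disc_body_scaleR: "h \<in> disc_body r \<xi> \<epsilon> \<Longrightarrow> \<bar>c\<bar> \<le> 1 \<Longrightarrow> c *\<^sub>R h \<in> disc_body r \<xi> \<epsilon>"
  using disc_body_smult[of h r \<xi> \<epsilon> "of_real c"] by (simp add: of_real_vector_smult)

lemma disc_body_minus: "h \<in> disc_body r \<xi> \<epsilon> \<Longrightarrow> - h \<in> disc_body r \<xi> \<epsilon>"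
  using disc_body_scaleR[of h r \<xi> \<epsilon> "-1"] by simp

text \<open>Bounded sublevel sets make every disc body compact, so that \<open>tau\<close> is an
  attained maximum, and ensure that every complex line reaches the level on which
  \<open>linedist\<close> is measured.\<close>

locale convex_exhaustion =
  fixes r :: "complex^'n \<Rightarrow> real"
  assumes convex: "convex_on UNIV r" and smooth: "smooth_fun r"
    and bounded_sublevel: "bounded {z. r z \<le> c}"
begin

lemma cont: "continuous_on A f \<Longrightarrow> continuous_on A (\<lambda>x. r (f x))"
  using continuous_on_compose2[OF smooth_fun_continuous[OF smooth]] by blast

lemma star_ineq:
  assumes "0 \<le> t" "t \<le> 1"
  shows "r (\<xi> + t *\<^sub>R h) - r \<xi> \<le> t * (r (\<xi> + h) - r \<xi>)"
proof -
  have "\<xi> + t *\<^sub>R h = (1 - t) *\<^sub>R \<xi> + t *\<^sub>R (\<xi> + h)" by (simp add: algebra_simps)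
  then show ?thesis
    using convex_onD[OF convex, of t \<xi> "\<xi> + h"] assms by (simp add: algebra_simps)
qed

text \<open>Tangent inequality: the difference quotients along the ray converge to the left side,
  and by convexity each is at most the quotient at t = 1.\<close>

lemma grad_le: "grad r \<xi> \<bullet> h \<le> r (\<xi> + h) - r \<xi>"
proof -
  let ?f = "\<lambda>t. r (\<xi> + t *\<^sub>R h)"
  have "(?f has_derivative (\<lambda>t. grad r (\<xi> + 0 *\<^sub>R h) \<bullet> (t *\<^sub>R h))) (at 0)"
    by (rule has_derivative_compose[OF _ smooth_fun_grad[OF smooth]])
       (auto intro!: derivative_eq_intros)
  then have "(?f has_real_derivative (grad r \<xi> \<bullet> h)) (at 0)"
    unfolding has_field_derivative_def by (simp add: mult.commute[of _ "grad r \<xi> \<bullet> h"])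
  then have "((\<lambda>t. (r (\<xi> + t *\<^sub>R h) - r \<xi>) / t) \<longlongrightarrow> grad r \<xi> \<bullet> h) (at 0)"
    by (simp add: has_field_derivative_iff)
  then have "((\<lambda>t. (r (\<xi> + t *\<^sub>R h) - r \<xi>) / t) \<longlongrightarrow> grad r \<xi> \<bullet> h) (at_right 0)"
    by (rule filterlim_mono) (auto simp: at_le)
  moreover have "eventually (\<lambda>t::real. 0 < t \<and> t < 1) (at_right 0)"
    using eventually_at_right_real[of 0 1] by simp
  then have "eventually (\<lambda>t. (r (\<xi> + t *\<^sub>R h) - r \<xi>) / t \<le> r (\<xi> + h) - r \<xi>) (at_right 0)"
    by eventually_elim (use star_ineq in \<open>simp add: field_simps\<close>)
  ultimately show ?thesis
    by (intro tendsto_upperbound) auto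
qed

lemma convex_disc_body: "convex (disc_body r \<xi> \<epsilon>)"
proof (rule convexI)
  fix x y and a b :: real
  assume xy: "x \<in> disc_body r \<xi> \<epsilon>" "y \<in> disc_body r \<xi> \<epsilon>" and ab: "0 \<le> a" "0 \<le> b" "a + b = 1"
  have "r (\<xi> + l *s (a *\<^sub>R x + b *\<^sub>R y)) - r \<xi> \<le> \<epsilon>" if l: "cmod l \<le> 1" for l
  proof -
    have a: "a = 1 - b" using ab by simp
    have "\<xi> + l *s (a *\<^sub>R x + b *\<^sub>R y) = (1 - b) *\<^sub>R (\<xi> + l *s x) + b *\<^sub>R (\<xi> + l *s y)"
      unfolding a by (simp add: vec_eq_iff algebra_simps)
    then have "r (\<xi> + l *s (a *\<^sub>R x + b *\<^sub>R y)) \<le> (1 - b) * r (\<xi> + l *s x) + b * r (\<xi> + l *s y)"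
      using convex_onD[OF convex, of b] ab by simp
    also have "\<dots> \<le> (1 - b) * (r \<xi> + \<epsilon>) + b * (r \<xi> + \<epsilon>)"
      using xy l ab by (intro add_mono mult_left_mono) (auto simp: disc_body_def algebra_simps)
    finally show ?thesis by (simp add: algebra_simps)
  qed
  then show "a *\<^sub>R x + b *\<^sub>R y \<in> disc_body r \<xi> \<epsilon>"
    by (simp add: disc_body_def)
qed

text \<open>The centre is the midpoint of the points displaced by \<open>l *s h\<close> and
  \<open>(- l) *s h\<close>, so a drop on one side is at most the rise on the other.\<close>

lemma disc_body_abs:
  assumes "h \<in> disc_body r \<xi> \<epsilon>" "cmod l \<le> 1"
  shows "\<bar>r (\<xi> + l *s h) - r \<xi>\<bar> \<le> \<epsilon>"
proof -
  have D: "r (\<xi> + l *s h) - r \<xi> \<le> \<epsilon>" if "cmod l \<le> 1" for l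
    using assms(1) that by (simp add: disc_body_def)
  have "\<xi> = (1 - 1/2) *\<^sub>R (\<xi> + l *s h) + (1/2) *\<^sub>R (\<xi> + (- l) *s h)"
    by (simp add: vec_eq_iff scaleR_conv_of_real[where 'a = complex] field_simps)
  then have "r \<xi> \<le> (1 - 1/2) * r (\<xi> + l *s h) + (1/2) * r (\<xi> + (- l) *s h)"
    using convex_onD[OF convex, of "1/2" "\<xi> + l *s h" "\<xi> + (- l) *s h"] by simp
  moreover have "r (\<xi> + l *s h) - r \<xi> \<le> \<epsilon>" "r (\<xi> + (- l) *s h) - r \<xi> \<le> \<epsilon>"
    using D[OF assms(2)] D[of "- l"] assms(2) by simp_all
  ultimately show ?thesis by (simp add: abs_le_iff)
qed

lemma compact_disc_body: "compact (disc_body r \<xi> \<epsilon>)"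
proof -
  have eq: "disc_body r \<xi> \<epsilon> = (\<Inter>l\<in>cball 0 1. {h. r (\<xi> + l *s h) - r \<xi> \<le> \<epsilon>})"
    by (auto simp: disc_body_def)
  have "closed (disc_body r \<xi> \<epsilon>)"
    unfolding eq by (intro closed_INT ballI closed_Collect_le continuous_intros cont)
  moreover have "disc_body r \<xi> \<epsilon> \<subseteq> (+) (- \<xi>) ` {z. r z \<le> r \<xi> + \<epsilon>}"
  proof
    fix h assume "h \<in> disc_body r \<xi> \<epsilon>"
    then have "r (\<xi> + 1 *s h) - r \<xi> \<le> \<epsilon>"
      by (rule disc_bodyD) simp
    then show "h \<in> (+) (- \<xi>) ` {z. r z \<le> r \<xi> + \<epsilon>}"
      by (intro image_eqI[of _ _ "\<xi> + h"]) auto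
  qed
  then have "bounded (disc_body r \<xi> \<epsilon>)"
    using bounded_translation[OF bounded_sublevel] bounded_subset by blast
  ultimately show ?thesis by (simp add: compact_eq_bounded_closed)
qed

lemma disc_body_ball:
  assumes "\<epsilon> > 0"
  shows "\<exists>d>0. cball 0 d \<subseteq> disc_body r \<xi> \<epsilon>"
proof -
  have "continuous (at \<xi>) r"
    using cont[of UNIV "\<lambda>x. x"] by (simp add: continuous_on_eq_continuous_at)
  then obtain d where d: "d > 0" "\<And>x. dist x \<xi> < d \<Longrightarrow> dist (r x) (r \<xi>) < \<epsilon>"
    using assms unfolding continuous_at_eps_delta by metis
  have "cball 0 (d/2) \<subseteq> disc_body r \<xi> \<epsilon>"
    unfolding disc_body_def
  proof clarify
    fix h :: "complex^'n" and l assume "h \<in> cball 0 (d/2)" "cmod l \<le> 1"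
    then have "norm (l *s h) < d"
      using d mult_mono[of "cmod l" 1 "norm h" "d/2"] by (simp add: norm_vector_smult)
    then have "dist (r (\<xi> + l *s h)) (r \<xi>) < \<epsilon>"
      by (intro d) (simp add: dist_norm)
    then show "r (\<xi> + l *s h) - r \<xi> \<le> \<epsilon>" by (simp add: dist_real_def)
  qed
  then show ?thesis using d by (intro exI[of _ "d/2"]) auto
qed

section \<open>Tau, line distance and existence of extremal bases\<close>

lemma tau_props:
  assumes "\<epsilon> > 0" "u \<noteq> 0"
  shows tau_pos: "tau r \<xi> u \<epsilon> > 0"
    and tau_mem: "tau r \<xi> u \<epsilon> *\<^sub>R u \<in> disc_body r \<xi> \<epsilon>"
    and tau_ge: "c *\<^sub>R u \<in> disc_body r \<xi> \<epsilon> \<Longrightarrow> c \<le> tau r \<xi> u \<epsilon>"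
proof -
  let ?S = "disc_body r \<xi> \<epsilon>"
  have T: "{c. c > 0 \<and> (\<forall>l::complex. cmod l \<le> c \<longrightarrow> \<bar>r (\<xi> + l *s u) - r \<xi>\<bar> \<le> \<epsilon>)} = {c. c > 0 \<and> c *\<^sub>R u \<in> ?S}"
    (is "?L = ?R")
  proof (intro equalityI subsetI)
    fix c assume c: "c \<in> ?L"
    have "r (\<xi> + l *s (c *\<^sub>R u)) - r \<xi> \<le> \<epsilon>" if "cmod l \<le> 1" for l
    proof -
      have "cmod (l * of_real c) \<le> c"
        using that c by (simp add: norm_mult mult_left_le_one_le)
      then show ?thesis
        using c unfolding vector_smult_scaleR by fastforce
    qed
    then show "c \<in> ?R" using c by (simp add: disc_body_def)
  next
    fix c assume c: "c \<in> ?R"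
    have "\<bar>r (\<xi> + l *s u) - r \<xi>\<bar> \<le> \<epsilon>" if "cmod l \<le> c" for l
    proof -
      have "l *s u = (l / of_real c) *s (c *\<^sub>R u)"
        using c by (simp add: vector_smult_scaleR)
      moreover have "cmod (l / of_real c) \<le> 1"
        using c that by (simp add: norm_divide)
      ultimately show ?thesis
        using disc_body_abs[of "c *\<^sub>R u"] c by simp
    qed
    then show "c \<in> ?L" using c by simp
  qed
  \<comment> \<open>Dropping the condition c > 0 yields a closed set, so a maximum exists; the small
    ball in the body shows that this maximum is positive.\<close>
  define T where "T = {c. c *\<^sub>R u \<in> ?S}"
  have "closed T"
    unfolding T_def using compact_imp_closed[OF compact_disc_body]
    by (intro closed_vimage[of _ "\<lambda>c. c *\<^sub>R u", unfolded vimage_def] continuous_intros) auto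
  moreover have "bounded T"
  proof -
    obtain R where R: "\<And>h. h \<in> ?S \<Longrightarrow> norm h \<le> R"
      using compact_imp_bounded[OF compact_disc_body] unfolding bounded_iff by metis
    have "norm c \<le> R / norm u" if "c \<in> T" for c
      using R[of "c *\<^sub>R u"] that assms by (simp add: T_def field_simps)
    then show ?thesis by (auto simp: bounded_iff)
  qed
  moreover obtain d where d: "d > 0" "cball 0 d \<subseteq> ?S"
    using disc_body_ball assms by blast
  then have dT: "d / norm u \<in> T"
    using assms by (auto simp: T_def)
  ultimately obtain m where m: "m \<in> T" "\<And>c. c \<in> T \<Longrightarrow> c \<le> m"
    using compact_attains_sup[of T] by (auto simp: compact_eq_bounded_closed)
  have "0 < d / norm u" using d assms by simp
  then have "m > 0" using m(2)[OF dT] by linarith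
  then have "tau r \<xi> u \<epsilon> = m"
    unfolding tau_def T using m by (intro cSup_eq_maximum) (auto simp: T_def)
  then show "tau r \<xi> u \<epsilon> > 0" "tau r \<xi> u \<epsilon> *\<^sub>R u \<in> ?S"
    "c *\<^sub>R u \<in> ?S \<Longrightarrow> c \<le> tau r \<xi> u \<epsilon>"
    using m \<open>m > 0\<close> by (auto simp: T_def)
qed

text \<open>Strictly inside radius \<open>tau\<close> the increment is a proper fraction of one that
  is at most \<epsilon>, so the level is not reached there. Conversely, at the nearest point of the
  level the whole disc of that radius satisfies the bound. This makes the extremal basis accessible
  through the body.\<close>

lemma linedist_eq_tau:
  assumes "\<epsilon> > 0" "u \<noteq> 0"
  shows "linedist r \<xi> u \<epsilon> = tau r \<xi> u \<epsilon>"
proof -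
  let ?m = "tau r \<xi> u \<epsilon>"
  note m = tau_props[OF assms, where \<xi> = \<xi>]
  have ge: "?m \<le> cmod l" if l: "r (\<xi> + l *s u) = r \<xi> + \<epsilon>" for l
  proof (rule ccontr)
    assume "\<not> ?m \<le> cmod l"
    then have lt: "cmod l < ?m" by simp
    \<comment> \<open>For l = 0 division by zero gives k = 0, so the modulus is at most 1 and not
      always equal to 1.\<close>
    define k where "k = l / of_real (cmod l)"
    have k: "cmod k \<le> 1" by (simp add: k_def norm_divide)
    have "l *s u = (cmod l / ?m) *\<^sub>R (k *s (?m *\<^sub>R u))"
      using m(1) by (simp add: k_def vector_smult_assoc vector_smult_scaleR flip: of_real_vector_smult)
    moreover have "r (\<xi> + k *s (?m *\<^sub>R u)) - r \<xi> \<le> \<epsilon>"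
      using disc_body_abs[OF m(2) k] by linarith
    then have "cmod l / ?m * (r (\<xi> + k *s (?m *\<^sub>R u)) - r \<xi>) \<le> cmod l / ?m * \<epsilon>"
      using m(1) by (intro mult_left_mono) auto
    moreover have "cmod l / ?m * \<epsilon> < 1 * \<epsilon>"
      using lt m(1) assms by (intro mult_strict_right_mono) auto
    moreover have "cmod l / ?m \<le> 1" "0 \<le> cmod l / ?m" using lt m(1) by auto
    ultimately show False
      using star_ineq[of "cmod l / ?m" \<xi> "k *s (?m *\<^sub>R u)"] l by simp
  qed
  \<comment> \<open>The superlevel set is used because its nonemptiness follows at once: otherwise
    the whole complex line would lie in a bounded sublevel set. That its point nearest to 0 attains
    equality follows by taking the closure of the open disc that avoids E.\<close>
  define E where "E = {l. r (\<xi> + l *s u) \<ge> r \<xi> + \<epsilon>}"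
  have "closed E"
    unfolding E_def by (intro closed_Collect_le continuous_intros cont)
  moreover have "E \<noteq> {}"
  proof
    assume "E = {}"
    then have sub: "r (\<xi> + l *s u) \<le> r \<xi> + \<epsilon>" for l
      by (simp add: E_def set_eq_iff) (meson linear)
    obtain R where R: "\<And>z. r z \<le> r \<xi> + \<epsilon> \<Longrightarrow> norm z \<le> R"
      using bounded_sublevel[of "r \<xi> + \<epsilon>"] by (auto simp: bounded_iff)
    define t where "t = (\<bar>R\<bar> + norm \<xi> + 1) / norm u"
    have "norm (\<xi> + of_real t *s u) \<le> R" by (intro R sub)
    moreover have "norm (complex_of_real t *s u) = \<bar>R\<bar> + norm \<xi> + 1"
      unfolding norm_vector_smult norm_of_real using assms by (simp add: t_def)
    moreover have "norm (complex_of_real t *s u) \<le> norm (\<xi> + of_real t *s u) + norm \<xi>"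
      by (metis add_diff_cancel_left' norm_triangle_ineq4)
    ultimately show False by linarith
  qed
  ultimately obtain l1 where l1: "l1 \<in> E" "\<And>l. l \<in> E \<Longrightarrow> cmod l1 \<le> cmod l"
    using distance_attains_inf[of E 0] by (metis dist_0_norm)
  then have "l1 \<noteq> 0" using assms by (auto simp: E_def)
  have "closure (ball 0 (cmod l1)) \<subseteq> {l. r (\<xi> + l *s u) \<le> r \<xi> + \<epsilon>}"
  proof (rule closure_minimal)
    show "ball 0 (cmod l1) \<subseteq> {l. r (\<xi> + l *s u) \<le> r \<xi> + \<epsilon>}"
      using l1(2) by (force simp: E_def not_le[symmetric])
    show "closed {l. r (\<xi> + l *s u) \<le> r \<xi> + \<epsilon>}"
      by (intro closed_Collect_le continuous_intros cont)
  qed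
  then have le: "r (\<xi> + l *s u) \<le> r \<xi> + \<epsilon>" if "cmod l \<le> cmod l1" for l
    using that \<open>l1 \<noteq> 0\<close> by (auto simp: subset_iff)
  then have l1eq: "r (\<xi> + l1 *s u) = r \<xi> + \<epsilon>"
    using l1(1) by (auto simp: E_def intro: antisym)
  have "cmod l1 *\<^sub>R u \<in> disc_body r \<xi> \<epsilon>"
    unfolding disc_body_def mem_Collect_eq vector_smult_scaleR
    using le by (auto simp: norm_mult mult_left_le_one_le algebra_simps)
  then have "cmod l1 \<le> ?m" by (rule m(3))
  with ge[OF l1eq] have "?m = cmod l1" by simp
  then show ?thesis
    unfolding linedist_def using ge l1eq by (intro cInf_eq_minimum) auto
qed

text \<open>The sphere is not searched for a maximum of \<open>tau\<close>, whose continuity would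
  be needed. A longest vector of the compact set \<open>?S \<inter> W\<close> is normalised instead;
  its length dominates \<open>tau\<close> in every admissible direction.\<close>

lemma ex_tau_maximal:
  assumes "\<epsilon> > 0" "k < CARD('n)"
  shows "\<exists>v. norm v = 1 \<and> (\<forall>j<k. cinner v (b j) = 0) \<and>
    (\<forall>u. norm u = 1 \<and> (\<forall>j<k. cinner u (b j) = 0) \<longrightarrow> linedist r \<xi> u \<epsilon> \<le> linedist r \<xi> v \<epsilon>)"
proof -
  let ?S = "disc_body r \<xi> \<epsilon>"
  define W where "W = {u. \<forall>j<k. cinner u (b j) = 0}"
  have "W = (\<Inter>j\<in>{..<k}. {u. cinner u (b j) = 0})" by (auto simp: W_def)
  then have "closed W"
    by (auto intro!: closed_INT closed_Collect_eq continuous_on_cinner_left continuous_intros)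
  then have cpt: "compact (?S \<inter> W)"
    using compact_disc_body by (rule compact_Int_closed[rotated])
  have W_scale: "c *\<^sub>R u \<in> W" if "u \<in> W" for c u
    using that by (simp add: W_def cinner_scaleR_left)
  obtain w where w: "w \<noteq> 0" "w \<in> W"
    using ex_nonzero_cinner_orthogonal[OF assms(2), of b] by (auto simp: W_def)
  have tw: "tau r \<xi> w \<epsilon> *\<^sub>R w \<in> ?S \<inter> W" "tau r \<xi> w \<epsilon> *\<^sub>R w \<noteq> 0"
    using tau_props[OF assms(1) w(1), where \<xi> = \<xi>] w W_scale by auto
  obtain x where x: "x \<in> ?S \<inter> W" "\<And>y. y \<in> ?S \<inter> W \<Longrightarrow> norm y \<le> norm x"
    using continuous_attains_sup[OF cpt _ continuous_on_norm_id] tw by blast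
  have "x \<noteq> 0" using x(2)[OF tw(1)] tw(2) by (metis norm_le_zero_iff norm_zero)
  define v where "v = (1 / norm x) *\<^sub>R x"
  have v: "norm v = 1" "v \<in> W" "norm x *\<^sub>R v = x"
    using \<open>x \<noteq> 0\<close> x W_scale by (auto simp: v_def)
  then have v0: "v \<noteq> 0" by auto
  have "linedist r \<xi> u \<epsilon> \<le> linedist r \<xi> v \<epsilon>" if u: "norm u = 1" "u \<in> W" for u
  proof -
    have u0: "u \<noteq> 0" using u by auto
    have "tau r \<xi> u \<epsilon> *\<^sub>R u \<in> ?S \<inter> W"
      using tau_mem[OF assms(1) u0] W_scale[OF u(2)] by auto
    from x(2)[OF this] have "tau r \<xi> u \<epsilon> \<le> norm x"
      using u by simp
    also have "norm x \<le> tau r \<xi> v \<epsilon>"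
      using v x by (intro tau_ge[OF assms(1) v0]) auto
    finally show ?thesis using u0 v0 assms by (simp add: linedist_eq_tau)
  qed
  then show ?thesis using v by (auto simp: W_def intro!: exI[of _ v])
qed

lemma ex_extremal_basis:
  assumes "\<epsilon> > 0"
  shows "\<exists>b. extremal_basis r \<xi> \<epsilon> b"
proof -
  define Q where "Q b k v \<longleftrightarrow> norm v = 1 \<and> (\<forall>j<k. cinner v (b j) = 0) \<and>
    (\<forall>u. norm u = 1 \<and> (\<forall>j<k. cinner u (b j) = 0) \<longrightarrow> linedist r \<xi> u \<epsilon> \<le> linedist r \<xi> v \<epsilon>)"
    for b :: "nat \<Rightarrow> complex^'n" and k v
  have "\<exists>b. b 0 = (1 / norm (grad r \<xi>)) *\<^sub>R grad r \<xi> \<and> (\<forall>k\<in>{1..<m}. Q b k (b k))"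
    if "m \<le> CARD('n)" for m
    using that
  proof (induction m)
    case 0
    then show ?case by auto
  next
    case (Suc m)
    show ?case
    proof (cases "m = 0")
      case True
      then show ?thesis by auto
    next
      case False
      obtain b where b: "b 0 = (1 / norm (grad r \<xi>)) *\<^sub>R grad r \<xi>" "\<forall>k\<in>{1..<m}. Q b k (b k)"
        using Suc by auto
      obtain v where v: "Q b m v"
        using ex_tau_maximal[OF assms, of m b \<xi>] Suc.prems unfolding Q_def by auto
      \<comment> \<open>The condition at k reads only entries below k, so assigning entry m
        preserves the conditions for k up to m.\<close>
      have "Q (b(m := v)) k x = Q b k x" if "k \<le> m" for k x
      proof -
        have "j < k \<Longrightarrow> (b(m := v)) j = b j" for j using that by auto
        then show ?thesis unfolding Q_def by (auto simp del: fun_upd_apply)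
      qed
      then have "\<forall>k\<in>{1..<Suc m}. Q (b(m := v)) k ((b(m := v)) k)"
        using b(2) v by (auto simp: less_Suc_eq simp del: fun_upd_apply) (auto)
      then show ?thesis
        using b(1) False by (intro exI[of _ "b(m := v)"]) (simp del: fun_upd_apply, simp)
    qed
  qed
  from this[of "CARD('n)"] show ?thesis
    unfolding extremal_basis_def Q_def by auto
qed

section \<open>Coordinates in an extremal basis, and comparison of bodies with polydiscs\<close>

lemma cmod_cinner_grad_le:
  assumes "h \<in> disc_body r \<xi> \<epsilon>"
  shows "cmod (cinner h (grad r \<xi>)) \<le> \<epsilon>"
proof -
  \<comment> \<open>A rotation turns the modulus of the Hermitian product into a real inner product,
    and the body admits rotations.\<close>
  obtain c where c: "cmod c = 1" "(c *s h) \<bullet> grad r \<xi> = cmod (cinner h (grad r \<xi>))"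
    using ex_unimodular_inner by blast
  have "grad r \<xi> \<bullet> (c *s h) \<le> r (\<xi> + c *s h) - r \<xi>" by (rule grad_le)
  also have "\<dots> \<le> \<epsilon>" using disc_bodyD[OF assms, of c] c by simp
  finally show ?thesis using c by (simp add: inner_commute)
qed

text \<open>Components are removed one after another; \<open>H k\<close> is what is left of h after
  k of them. For k = 0 the gradient inequality bounds the coordinate by \<epsilon>, while the ball
  of radius \<open>\<epsilon> / L\<close> gives tau at least \<open>\<epsilon> / L\<close>. The
  factor 1 + L covers this ratio and the initial membership of h, and each removal contributes a
  factor 2.\<close>

lemma extremal_coordinate_bound:
  fixes b :: "nat \<Rightarrow> complex^'n"
  assumes \<epsilon>: "\<epsilon> > 0" and b: "extremal_basis r \<xi> \<epsilon> b" and grad: "norm (grad r \<xi>) = 1"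
    and L: "L \<ge> 1" "cball 0 (\<epsilon> / L) \<subseteq> disc_body r \<xi> \<epsilon>"
    and h: "h \<in> disc_body r \<xi> \<epsilon>" and k: "k < CARD('n)"
  shows "cmod (cinner h (b k)) \<le> (1 + L) * 2 ^ CARD('n) * tau r \<xi> (b k) \<epsilon>"
proof -
  let ?S = "disc_body r \<xi> \<epsilon>" and ?\<tau> = "\<lambda>u. tau r \<xi> u \<epsilon>"
  have b0: "b 0 = grad r \<xi>"
    using b grad by (simp add: extremal_basis_def)
  have norm_b: "norm (b k) = 1" if "k < CARD('n)" for k
    using b grad that b0 by (cases "k = 0") (auto simp: extremal_basis_def)
  have nz: "b k \<noteq> 0" if "k < CARD('n)" for k
    using norm_b[OF that] by auto
  have orth: "cinner (b k) (b j) = 0" if "k < CARD('n)" "j < k" for j k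
    using b that by (auto simp: extremal_basis_def)
  have orth': "cinner (b j) (b k) = 0" if "k < CARD('n)" "j < k" for j k
    using orth[OF that] by (metis cnj_cinner complex_cnj_zero)
  have tau_mono: "?\<tau> u \<le> ?\<tau> (b k)"
    if "0 < k" "k < CARD('n)" "norm u = 1" "\<And>j. j < k \<Longrightarrow> cinner u (b j) = 0" for u k
  proof -
    have "linedist r \<xi> u \<epsilon> \<le> linedist r \<xi> (b k) \<epsilon>"
      using b that by (auto simp: extremal_basis_def)
    moreover have "u \<noteq> 0" using that by auto
    ultimately show ?thesis using nz that \<epsilon> by (simp add: linedist_eq_tau)
  qed
  define H where "H k = h - (\<Sum>j<k. cinner h (b j) *s b j)" for k
  have H_Suc: "H (Suc k) = H k - cinner h (b k) *s b k" for k
    by (simp add: H_def)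
  have H_ge: "cinner (H k) (b i) = cinner h (b i)" if "k \<le> i" "i < CARD('n)" for i k
    using that by (simp add: H_def cinner_diff_left cinner_sum_left cinner_smult_left orth')
  have H_less: "cinner (H k) (b i) = 0" if "k \<le> CARD('n)" "i < k" for i k
    using that
  proof (induction k)
    case (Suc k)
    show ?case
    proof (cases "i = k")
      case True
      then show ?thesis
        using Suc.prems H_ge[of k k]
        by (simp add: H_Suc cinner_diff_left cinner_smult_left cinner_self norm_b)
    next
      case False
      then show ?thesis
        using Suc by (simp add: H_Suc cinner_diff_left cinner_smult_left orth)
    qed
  qed simp
  have first: "cmod (cinner h (b 0)) \<le> L * ?\<tau> (b 0)"
  proof -
    have "norm (b 0) = 1" using norm_b by simp
    then have "(\<epsilon> / L) *\<^sub>R b 0 \<in> ?S"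
      using L \<epsilon> by (intro subsetD[OF L(2)]) simp
    then have "\<epsilon> / L \<le> ?\<tau> (b 0)" using tau_ge[OF \<epsilon> nz[of 0]] by simp
    then show ?thesis
      using cmod_cinner_grad_le[OF h] L b0 by (simp add: field_simps)
  qed
  \<comment> \<open>Subtracting a component at most doubles the dilation of the body needed, since the next
    extremal vector maximises \<open>tau\<close> among the remaining directions.\<close>
  have step: "cmod (cinner h (b k)) \<le> s * ?\<tau> (b k) \<and> (1 / (2 * s)) *\<^sub>R H (Suc k) \<in> ?S"
    if s: "s > 0" "(1 / s) *\<^sub>R H k \<in> ?S" and k: "k < CARD('n)"
      and le: "cmod (cinner h (b k)) \<le> s * ?\<tau> (b k)" for s k
  proof -
    have "(1 / s) *\<^sub>R (cinner h (b k) *s b k) \<in> ?S"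
    proof -
      let ?t = "?\<tau> (b k)"
      have t: "?t > 0" using tau_pos[OF \<epsilon> nz[OF k]] .
      have "(1 / s) *\<^sub>R (cinner h (b k) *s b k)
          = (cinner h (b k) / of_real (s * ?t)) *s (?t *\<^sub>R b k)"
        using t by (simp add: vector_smult_scaleR vector_smult_assoc flip: of_real_vector_smult)
      moreover have "cmod (cinner h (b k) / of_real (s * ?t)) \<le> 1"
        using s t le by (simp add: norm_divide norm_mult)
      ultimately show ?thesis
        using disc_body_smult[OF tau_mem[OF \<epsilon> nz[OF k]]] by simp
    qed
    from convexD[OF convex_disc_body s(2) disc_body_minus[OF this], of "1/2" "1/2"]
    have "(1/2) *\<^sub>R (1 / s) *\<^sub>R H k + (1/2) *\<^sub>R (- ((1 / s) *\<^sub>R (cinner h (b k) *s b k))) \<in> ?S"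
      by simp
    also have "(1/2) *\<^sub>R (1 / s) *\<^sub>R H k + (1/2) *\<^sub>R (- ((1 / s) *\<^sub>R (cinner h (b k) *s b k)))
        = (1 / (2 * s)) *\<^sub>R H (Suc k)"
      by (simp add: H_Suc scaleR_right_diff_distrib)
    finally show ?thesis using le by blast
  qed
  have main: "cmod (cinner h (b k)) \<le> (1 + L) * 2 ^ k * ?\<tau> (b k) \<and>
      (1 / ((1 + L) * 2 ^ Suc k)) *\<^sub>R H (Suc k) \<in> ?S" if "k < CARD('n)" for k
    using that
  proof (induction k)
    case 0
    have "cmod (cinner h (b 0)) \<le> (1 + L) * ?\<tau> (b 0)"
      using first tau_pos[OF \<epsilon> nz[of 0], of \<xi>] by (simp add: algebra_simps)
    moreover have "(1 / (1 + L)) *\<^sub>R H 0 \<in> ?S"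
      using disc_body_scaleR[OF h, of "1 / (1 + L)"] L by (simp add: H_def)
    ultimately show ?case using step[of "1 + L" 0] L by (simp add: mult.commute)
  next
    case (Suc k)
    let ?s = "(1 + L) * 2 ^ Suc k" and ?x = "H (Suc k)"
    have s: "?s > 0" using L by simp
    have xs: "(1 / ?s) *\<^sub>R ?x \<in> ?S" using Suc by simp
    \<comment> \<open>The remainder is orthogonal to all earlier vectors, so its direction competes
      in the extremal choice of \<open>b (Suc k)\<close>; this bounds its whole norm, and therefore
      its component.\<close>
    have "cmod (cinner ?x (b (Suc k))) \<le> ?s * ?\<tau> (b (Suc k))"
    proof (cases "?x = 0")
      case True
      then show ?thesis using s tau_pos[OF \<epsilon> nz[OF Suc.prems], of \<xi>] by simp
    next
      case False
      define u where "u = (1 / norm ?x) *\<^sub>R ?x"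
      have u: "norm u = 1" "norm ?x *\<^sub>R u = ?x" using False by (simp_all add: u_def)
      have "norm ?x / ?s \<le> ?\<tau> u"
      proof (rule tau_ge[OF \<epsilon>])
        show "u \<noteq> 0" using u by auto
        have "(norm ?x / ?s) *\<^sub>R u = (1 / ?s) *\<^sub>R norm ?x *\<^sub>R u" by simp
        then show "(norm ?x / ?s) *\<^sub>R u \<in> ?S" using xs u by metis
      qed
      also have "\<dots> \<le> ?\<tau> (b (Suc k))"
      proof (rule tau_mono)
        show "cinner u (b j) = 0" if "j < Suc k" for j
          using H_less[of "Suc k" j] Suc.prems that by (simp add: u_def cinner_scaleR_left)
      qed (use Suc.prems u in auto)
      finally have "norm ?x \<le> ?s * ?\<tau> (b (Suc k))" using s by (simp add: field_simps)
      then show ?thesis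
        using cmod_cinner_le[of ?x "b (Suc k)"] norm_b[OF Suc.prems] by simp
    qed
    then have "cmod (cinner h (b (Suc k))) \<le> ?s * ?\<tau> (b (Suc k))"
      using H_ge[of "Suc k" "Suc k"] Suc.prems by simp
    from step[OF s xs Suc.prems this] show ?case
      by (simp add: mult_ac)
  qed
  have "(2::real) ^ k \<le> 2 ^ CARD('n)" using k by (intro power_increasing) auto
  then have "(1 + L) * 2 ^ k * ?\<tau> (b k) \<le> (1 + L) * 2 ^ CARD('n) * ?\<tau> (b k)"
    using L tau_pos[OF \<epsilon> nz[OF k], of \<xi>] by (intro mult_right_mono mult_left_mono) auto
  then show ?thesis using main[OF k] by linarith
qed

lemma extremal_ext_basis: "\<epsilon> > 0 \<Longrightarrow> extremal_basis r \<xi> \<epsilon> (ext_basis r \<xi> \<epsilon>)"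
  unfolding ext_basis_def by (rule someI_ex[OF ex_extremal_basis])

text \<open>The dilation factor is the constant of the coordinate bound: applying that bound to the
  dilated vector leaves coordinates of h that are at most \<open>tau\<close>.\<close>

lemma disc_body_imp_polydisc:
  assumes \<epsilon>: "\<epsilon> > 0" and grad: "norm (grad r \<xi>) = 1"
    and L: "L \<ge> 1" "cball 0 (\<epsilon> / L) \<subseteq> disc_body r \<xi> \<epsilon>"
    and h: "((1 + L) * 2 ^ CARD('n)) *\<^sub>R h \<in> disc_body r \<xi> \<epsilon>"
  shows "\<xi> + h \<in> polydisc r \<epsilon> (\<xi> :: complex^'n)"
proof -
  let ?b = "ext_basis r \<xi> \<epsilon>" and ?A = "(1 + L) * 2 ^ CARD('n)"
  have b: "extremal_basis r \<xi> \<epsilon> ?b" by (rule extremal_ext_basis[OF \<epsilon>])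
  have norm_b: "norm (?b k) = 1" if "k < CARD('n)" for k
    using b grad that by (cases "k = 0") (auto simp: extremal_basis_def)
  have orth: "cinner (?b k) (?b j) = 0" if "k < CARD('n)" "j < k" for j k
    using b that by (auto simp: extremal_basis_def)
  have A: "?A > 0" using L by simp
  have "cmod (cinner h (?b k)) \<le> tau r \<xi> (?b k) \<epsilon>" if "k < CARD('n)" for k
  proof -
    have "?A * cmod (cinner h (?b k)) = cmod (cinner (?A *\<^sub>R h) (?b k))"
      unfolding cinner_scaleR_left norm_mult norm_of_real using A by simp
    also have "\<dots> \<le> ?A * tau r \<xi> (?b k) \<epsilon>"
      by (rule extremal_coordinate_bound[OF \<epsilon> b grad L h that])
    finally show ?thesis using A by (simp only: mult_le_cancel_left_pos)
  qed
  then show ?thesis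
    unfolding polydisc_def mem_Collect_eq
    by (intro exI[of _ "\<lambda>k. cinner h (?b k)"]) (simp add: orthonormal_expansion norm_b orth)
qed

text \<open>Each term \<open>c k *s ?b k\<close> lies in the body by invariance under the unit disc,
  and dividing their sum by the dimension takes the average in a convex set.\<close>

lemma polydisc_imp_disc_body:
  assumes \<epsilon>: "\<epsilon> > 0" and grad: "grad r \<xi> \<noteq> 0"
    and p: "p \<in> polydisc r \<epsilon> (\<xi> :: complex^'n)"
  shows "(1 / CARD('n)) *\<^sub>R (p - \<xi>) \<in> disc_body r \<xi> \<epsilon>"
proof -
  let ?b = "ext_basis r \<xi> \<epsilon>"
  have b: "extremal_basis r \<xi> \<epsilon> ?b" by (rule extremal_ext_basis[OF \<epsilon>])
  have nz: "?b k \<noteq> 0" if "k < CARD('n)" for k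
  proof -
    have "norm (?b k) = 1"
      using b grad that by (cases "k = 0") (auto simp: extremal_basis_def)
    then show ?thesis by auto
  qed
  obtain c where c: "p = \<xi> + (\<Sum>k<CARD('n). c k *s ?b k)"
    "\<And>k. k < CARD('n) \<Longrightarrow> cmod (c k) \<le> tau r \<xi> (?b k) \<epsilon>"
    using p unfolding polydisc_def by blast
  have "(\<Sum>k<CARD('n). (1 / CARD('n)) *\<^sub>R (c k *s ?b k)) \<in> disc_body r \<xi> \<epsilon>"
  proof (rule convex_sum[OF _ convex_disc_body])
    fix k assume "k \<in> {..<CARD('n)}"
    then have k: "k < CARD('n)" by simp
    let ?t = "tau r \<xi> (?b k) \<epsilon>"
    have t: "?t > 0" by (rule tau_pos[OF \<epsilon> nz[OF k]])
    have "c k *s ?b k = (c k / of_real ?t) *s (?t *\<^sub>R ?b k)"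
      using t by (simp add: vector_smult_scaleR)
    moreover have "cmod (c k / of_real ?t) \<le> 1"
      using c(2)[OF k] t by (simp add: norm_divide)
    ultimately show "c k *s ?b k \<in> disc_body r \<xi> \<epsilon>"
      using disc_body_smult[OF tau_mem[OF \<epsilon> nz[OF k]]] by metis
  qed auto
  then show ?thesis by (simp add: c(1) scaleR_sum_right)
qed

end

section \<open>Finite type and doubling\<close>

lemma dirder_bounded:
  assumes "smooth_fun f"
  shows "\<exists>L\<ge>1. \<forall>j\<le>N. \<forall>x v. norm x \<le> R \<and> norm v = 1 \<longrightarrow> \<bar>dirder j f v x\<bar> \<le> L"
proof -
  have "\<exists>L. \<forall>x v. norm x \<le> R \<and> norm v = 1 \<longrightarrow> \<bar>dirder j f v x\<bar> \<le> L" for j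
  proof -
    have "compact ((\<lambda>(x, v). dirder j f v x) ` (cball 0 R \<times> sphere 0 1))"
      by (intro compact_continuous_image compact_Times compact_cball compact_sphere
          continuous_on_subset[OF continuous_on_dirder[OF assms] subset_UNIV])
    from compact_imp_bounded[OF this]
    obtain L where "\<forall>x\<in>cball 0 R. \<forall>v\<in>sphere 0 1. \<bar>dirder j f v x\<bar> \<le> L"
      unfolding bounded_iff by auto
    then show ?thesis by (intro exI[of _ L]) simp
  qed
  then obtain L where L: "\<And>j x v. norm x \<le> R \<Longrightarrow> norm v = 1 \<Longrightarrow> \<bar>dirder j f v x\<bar> \<le> L j"
    by metis
  have "\<bar>dirder j f v x\<bar> \<le> Max (insert 1 (L ` {..N}))" if "j \<le> N" "norm x \<le> R" "norm v = 1" for j x v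
    using L[OF that(2,3), of j] that(1) by (intro order.trans[OF _ Max_ge]) auto
  then show ?thesis
    by (intro exI[of _ "Max (insert 1 (L ` {..N}))"]) auto
qed

lemma Maclaurin_remainder_bound:
  assumes "smooth_fun f" and v: "norm v = 1" and t: "0 \<le> t" "t \<le> 1" and x: "norm x + 1 \<le> R"
    and L: "\<And>x. norm x \<le> R \<Longrightarrow> \<bar>dirder n f v x\<bar> \<le> L"
  shows "\<bar>f (x + t *\<^sub>R v) - (\<Sum>j<n. dirder j f v x / fact j * t ^ j)\<bar> \<le> L * t ^ n"
proof -
  obtain s where s: "\<bar>s\<bar> \<le> \<bar>t\<bar>" and eq: "f (x + t *\<^sub>R v)
     = (\<Sum>j<n. dirder j f v x / fact j * t ^ j) + dirder n f v (x + s *\<^sub>R v) / fact n * t ^ n"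
    using Maclaurin_dirder[OF assms(1)] by blast
  have "norm (x + s *\<^sub>R v) \<le> norm x + \<bar>s\<bar>"
    using norm_triangle_ineq[of x "s *\<^sub>R v"] v by simp
  then have "\<bar>dirder n f v (x + s *\<^sub>R v)\<bar> \<le> L"
    using s t x by (intro L) simp
  moreover have "\<bar>dirder n f v (x + s *\<^sub>R v) / fact n\<bar> \<le> \<bar>dirder n f v (x + s *\<^sub>R v)\<bar>"
    by (simp add: divide_le_eq mult_le_cancel_left1 fact_ge_1)
  ultimately have "\<bar>dirder n f v (x + s *\<^sub>R v) / fact n\<bar> \<le> L" by linarith
  then show ?thesis
    using t mult_right_mono[of "\<bar>dirder n f v (x + s *\<^sub>R v) / fact n\<bar>" L "t ^ n"]
    by (simp add: eq abs_mult)
qed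

lemma bdry_eq_0:
  assumes "smooth_fun r" "p \<in> bdry r"
  shows "r p = 0"
proof -
  have c: "continuous_on UNIV r" by (rule smooth_fun_continuous[OF assms(1)])
  have "open (Omega r)"
    unfolding Omega_def using c by (intro open_Collect_less continuous_intros)
  then have "p \<notin> Omega r" "p \<in> closure (Omega r)"
    using assms(2) by (auto simp: bdry_def frontier_def interior_open)
  moreover have "closure (Omega r) \<subseteq> {z. r z \<le> 0}"
    using c by (intro closure_minimal closed_Collect_le continuous_intros) (auto simp: Omega_def)
  ultimately show ?thesis by (auto simp: Omega_def)
qed

section \<open>Uniform estimates over the boundary of an admissible domain\<close>

context
  fixes r :: "complex^'n \<Rightarrow> real"
  assumes adm: "admissible_defining_function r"
begin

lemma smooth_r: "smooth_fun r"
  using adm by (simp add: admissible_defining_function_def)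

lemma compact_bdry: "compact (bdry r)"
  using adm unfolding bdry_def admissible_defining_function_def
  by (intro compact_frontier_bounded) simp

lemma norm_grad_bdry: "p \<in> bdry r \<Longrightarrow> norm (grad r p) = 1"
  using adm by (simp add: admissible_defining_function_def)

text \<open>At distance R from z0 the function is nonnegative, whereas \<open>r z0 = - m\<close>.
  Convexity on the segment from z0 to w forces linear growth beyond that sphere, so boundedness of
  \<open>Omega r\<close> passes to all sublevel sets.\<close>

lemma convex_exhaustion_admissible: "convex_exhaustion r"
proof
  show conv: "convex_on UNIV r" using adm by (simp add: admissible_defining_function_def)
  show "smooth_fun r" by (rule smooth_r)
  fix c
  obtain z0 where z0: "r z0 < 0"
    using adm by (auto simp: admissible_defining_function_def Omega_def)
  have "bounded (Omega r)"
    using adm by (simp add: admissible_defining_function_def)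
  then obtain R where R: "R > 0" "\<And>z. r z < 0 \<Longrightarrow> dist z0 z < R"
    using bounded_subset_ballD[of "Omega r" z0] by (auto simp: Omega_def subset_iff)
  define m where "m = - r z0"
  have m: "m > 0" using z0 by (simp add: m_def)
  have "dist z0 w \<le> R * (1 + \<bar>c\<bar> / m)" if w: "r w \<le> c" for w
  proof (cases "dist z0 w \<le> R")
    case True
    also have "R * 1 \<le> R * (1 + \<bar>c\<bar> / m)" using R m by (intro mult_left_mono) auto
    finally show ?thesis by simp
  next
    case False
    define t where "t = R / dist z0 w"
    have "z0 \<noteq> w" using False R(1) by auto
    then have t: "0 < t" "t < 1" using False R(1) by (simp_all add: t_def divide_less_eq zero_less_divide_iff)
    have "dist z0 ((1 - t) *\<^sub>R z0 + t *\<^sub>R w) = R"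
    proof -
      have "z0 - ((1 - t) *\<^sub>R z0 + t *\<^sub>R w) = t *\<^sub>R (z0 - w)" by (simp add: algebra_simps)
      then have "dist z0 ((1 - t) *\<^sub>R z0 + t *\<^sub>R w) = t * dist z0 w"
        using t by (simp add: dist_norm)
      also have "\<dots> = R" using False R by (auto simp: t_def)
      finally show ?thesis .
    qed
    then have "0 \<le> r ((1 - t) *\<^sub>R z0 + t *\<^sub>R w)"
      using R(2)[of "(1 - t) *\<^sub>R z0 + t *\<^sub>R w"] by linarith
    also have "\<dots> \<le> (1 - t) * r z0 + t * r w"
      using convex_onD[OF conv, of t z0 w] t by simp
    also have "\<dots> \<le> (1 - t) * r z0 + t * \<bar>c\<bar>"
      using w t by (intro add_left_mono mult_left_mono) auto
    finally have "m \<le> t * (m + \<bar>c\<bar>)" by (simp add: m_def algebra_simps)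
    then have "dist z0 w * m \<le> R * (m + \<bar>c\<bar>)"
      using \<open>z0 \<noteq> w\<close> by (simp add: t_def pos_le_divide_eq mult.commute)
    then show ?thesis using m by (simp add: field_simps)
  qed
  then show "bounded {z. r z \<le> c}"
    unfolding bounded_def by blast
qed

interpretation convex_exhaustion r
  by (rule convex_exhaustion_admissible)

text \<open>A finite value M of the double supremum excludes contact of order \<open>Suc M\<close>
  at all boundary points and along all complex lines at once.\<close>

lemma finite_type_bound:
  "\<exists>M. \<forall>p\<in>bdry r. \<forall>v. v \<noteq> 0 \<longrightarrow> (\<lambda>l. r (p + l *s v)) \<notin> O[at 0](\<lambda>l. cmod l ^ Suc M)"
proof -
  have "(SUP p\<in>bdry r. SUP v\<in>{v. v \<noteq> 0}. contact_order r p v) < \<infinity>"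
    using adm by (simp add: admissible_defining_function_def finite_type_def)
  then obtain M where M: "(SUP p\<in>bdry r. SUP v\<in>{v. v \<noteq> 0}. contact_order r p v) = enat M"
    by auto
  have "m \<le> M" if "p \<in> bdry r" "v \<noteq> 0" "(\<lambda>l. r (p + l *s v)) \<in> O[at 0](\<lambda>l. cmod l ^ m)" for p v m
  proof -
    have "enat m \<le> contact_order r p v"
      unfolding contact_order_def using that by (intro Sup_upper) auto
    also have "\<dots> \<le> (SUP v\<in>{v. v \<noteq> 0}. contact_order r p v)"
      using that by (intro SUP_upper) auto
    also have "\<dots> \<le> enat M"
      unfolding M[symmetric] using that by (intro SUP_upper)
    finally show ?thesis by simp
  qed
  then show ?thesis
    by (intro exI[of _ M]) (metis Suc_n_not_le_n)
qed

lemma bdry_norm_bound: "\<exists>R. \<forall>p\<in>bdry r. norm p + 1 \<le> R"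
proof -
  obtain R where "\<forall>p\<in>bdry r. norm p \<le> R"
    using compact_imp_bounded[OF compact_bdry] unfolding bounded_iff by blast
  then show ?thesis by (intro exI[of _ "R + 1"]) auto
qed

text \<open>If no c worked, a compactness limit would give a boundary point and a complex line along
  which all derivatives up to order M vanish in every real direction. Taylor's formula would then
  bound r by a multiple of \<open>cmod l ^ Suc M\<close> there, against finite type.\<close>

lemma jet_lower_bound:
  "\<exists>M. \<exists>c>0. \<forall>p\<in>bdry r. \<forall>u. norm u = 1 \<longrightarrow>
     (\<exists>w. cmod w = 1 \<and> c \<le> (\<Sum>j\<le>M. \<bar>dirder j r (w *s u) p / fact j\<bar>))"
proof -
  obtain M where M: "\<And>p v. p \<in> bdry r \<Longrightarrow> v \<noteq> 0 \<Longrightarrow>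
      (\<lambda>l. r (p + l *s v)) \<notin> O[at 0](\<lambda>l. cmod l ^ Suc M)"
    using finite_type_bound by blast
  define J where "J p v = (\<Sum>j\<le>M. \<bar>dirder j r v p / fact j\<bar>)" for p v
  have "\<exists>c>0. \<forall>p\<in>bdry r. \<forall>u. norm u = 1 \<longrightarrow> (\<exists>w. cmod w = 1 \<and> c \<le> J p (w *s u))"
  proof (rule ccontr)
    assume "\<not> ?thesis"
    then have "\<exists>p u. p \<in> bdry r \<and> norm u = 1 \<and> (\<forall>w. cmod w = 1 \<longrightarrow> J p (w *s u) < c)"
      if "c > 0" for c
      using that by (meson not_le_imp_less)
    then have "\<exists>x. fst x \<in> bdry r \<and> norm (snd x) = 1 \<and>
        (\<forall>w. cmod w = 1 \<longrightarrow> J (fst x) (w *s snd x) < 1 / real (Suc n))" for n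
      by (metis fst_conv snd_conv zero_less_divide_1_iff of_nat_0_less_iff zero_less_Suc)
    then obtain X where X: "\<And>n. fst (X n) \<in> bdry r" "\<And>n. norm (snd (X n)) = 1"
      "\<And>n w. cmod w = 1 \<Longrightarrow> J (fst (X n)) (w *s snd (X n)) < 1 / real (Suc n)"
      by metis
    have "compact (bdry r \<times> sphere (0 :: complex^'n) 1)"
      by (intro compact_Times compact_bdry compact_sphere)
    moreover have "X n \<in> bdry r \<times> sphere 0 1" for n
      using X by (simp add: mem_Times_iff)
    ultimately obtain x \<rho> where x: "x \<in> bdry r \<times> sphere 0 1" "strict_mono (\<rho> :: nat \<Rightarrow> nat)"
      and lim: "(X \<circ> \<rho>) \<longlonglongrightarrow> x"
      unfolding compact_def by meson
    obtain p u where pu: "x = (p, u)" "p \<in> bdry r" "norm u = 1"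
      using x by (cases x) auto
    \<comment> \<open>One convergent subsequence serves every w, since for fixed w the jet sum J is
      continuous in the point and the direction.\<close>
    have zero: "dirder j r (w *s u) p = 0" if w: "cmod w = 1" and j: "j \<le> M" for w j
    proof -
      have "continuous_on UNIV (\<lambda>y. \<Sum>j\<le>M. \<bar>(\<lambda>(x, v). dirder j r v x) (fst y, w *s snd y) / fact j\<bar>)"
        by (intro continuous_intros continuous_on_compose2[OF continuous_on_dirder[OF smooth_r]]) auto
      then have "continuous_on UNIV (\<lambda>y. J (fst y) (w *s snd y))" by (simp add: J_def)
      then have "isCont (\<lambda>y. J (fst y) (w *s snd y)) x"
        using continuous_on_eq_continuous_at[OF open_UNIV] by blast
      from isCont_tendsto_compose[OF this lim]
      have "(\<lambda>n. J (fst (X (\<rho> n))) (w *s snd (X (\<rho> n)))) \<longlonglongrightarrow> J p (w *s u)"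
        by (simp add: pu o_def)
      moreover have "(\<lambda>n. 1 / real (Suc (\<rho> n))) \<longlonglongrightarrow> 0"
        using LIMSEQ_subseq_LIMSEQ[OF LIMSEQ_inverse_real_of_nat x(2)]
        by (simp add: o_def inverse_eq_divide)
      ultimately have "J p (w *s u) \<le> 0"
        by (rule LIMSEQ_le) (use X(3)[OF w] in \<open>auto intro: less_imp_le\<close>)
      then have "(\<Sum>j\<le>M. \<bar>dirder j r (w *s u) p / fact j\<bar>) = 0"
        unfolding J_def by (intro antisym sum_nonneg) auto
      then have "\<bar>dirder j r (w *s u) p / fact j\<bar> = 0"
        using j by (subst (asm) sum_nonneg_eq_0_iff) auto
      then show ?thesis by simp
    qed
    obtain L where L: "\<And>x v. norm x \<le> norm p + 1 \<Longrightarrow> norm v = 1 \<Longrightarrow> \<bar>dirder (Suc M) r v x\<bar> \<le> L"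
      using dirder_bounded[OF smooth_r, of "Suc M" "norm p + 1"] by blast
    have "\<bar>r (p + l *s u)\<bar> \<le> L * cmod l ^ Suc M" if l: "cmod l < 1" for l
    proof -
      \<comment> \<open>At l = 0 the sign would vanish; the value 1 keeps w unimodular.\<close>
      define w where "w = (if l = 0 then 1 else sgn l)"
      have w: "cmod w = 1" by (simp add: w_def norm_sgn)
      have "l = of_real (cmod l) * w"
        by (simp add: w_def sgn_eq)
      then have lw: "l *s u = cmod l *\<^sub>R (w *s u)"
        by (metis of_real_vector_smult vector_smult_assoc)
      have "\<bar>r (p + cmod l *\<^sub>R (w *s u)) - (\<Sum>j<Suc M. dirder j r (w *s u) p / fact j * cmod l ^ j)\<bar>
          \<le> L * cmod l ^ Suc M"
        using l w pu by (intro Maclaurin_remainder_bound[OF smooth_r _ _ _ order_refl L])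
          (auto simp: norm_vector_smult)
      moreover have "(\<Sum>j<Suc M. dirder j r (w *s u) p / fact j * cmod l ^ j) = 0"
        using zero[OF w] by (intro sum.neutral) auto
      ultimately show ?thesis by (simp add: lw)
    qed
    then have "eventually (\<lambda>l. norm (r (p + l *s u)) \<le> L * norm (cmod l ^ Suc M)) (at 0)"
      unfolding eventually_at by (intro exI[of _ 1]) (auto simp: norm_power)
    then have "(\<lambda>l. r (p + l *s u)) \<in> O[at 0](\<lambda>l. cmod l ^ Suc M)"
      by (rule bigoI)
    moreover have "u \<noteq> 0" using pu by auto
    ultimately show False using M pu by blast
  qed
  then show ?thesis unfolding J_def by blast
qed

text \<open>Here the radius is uniform over the boundary and linear in \<epsilon>, by the Taylor
  bound of order 1. The conditions \<epsilon> at most 1 and L at least 1 keep displacements below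
  unit length, where the derivative bound is available.\<close>

lemma disc_body_lipschitz_ball:
  "\<exists>L\<ge>1. \<forall>p\<in>bdry r. \<forall>\<epsilon>\<in>{0<..1}. cball 0 (\<epsilon> / L) \<subseteq> disc_body r p \<epsilon>"
proof -
  obtain R where R: "\<And>p. p \<in> bdry r \<Longrightarrow> norm p + 1 \<le> R"
    using bdry_norm_bound by blast
  obtain L where L: "L \<ge> 1" "\<And>x v. norm x \<le> R \<Longrightarrow> norm v = 1 \<Longrightarrow> \<bar>dirder 1 r v x\<bar> \<le> L"
    using dirder_bounded[OF smooth_r, of 1 R] by blast
  have "r (p + l *s h) - r p \<le> \<epsilon>"
    if p: "p \<in> bdry r" and \<epsilon>: "0 < \<epsilon>" "\<epsilon> \<le> 1" and h: "norm h \<le> \<epsilon> / L" and l: "cmod l \<le> 1" for p \<epsilon> h l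
  proof -
    define k where "k = l *s h"
    have "norm k \<le> 1 * (\<epsilon> / L)"
      unfolding k_def norm_vector_smult using h l by (intro mult_mono) auto
    then have k: "L * norm k \<le> \<epsilon>"
      using L by (simp add: field_simps)
    show ?thesis
    proof (cases "k = 0")
      case True
      then show ?thesis using \<epsilon> by (simp add: k_def[symmetric])
    next
      case False
      have "1 * norm k \<le> L * norm k" using L by (intro mult_right_mono) auto
      then have "norm k \<le> 1" using k \<epsilon> by linarith
      then have "\<bar>r (p + norm k *\<^sub>R (k /\<^sub>R norm k))
          - (\<Sum>j<1. dirder j r (k /\<^sub>R norm k) p / fact j * norm k ^ j)\<bar> \<le> L * norm k ^ 1"
        using False by (intro Maclaurin_remainder_bound[OF smooth_r _ _ _ R[OF p] L(2)]) auto
      then have "\<bar>r (p + k) - r p\<bar> \<le> L * norm k" using False by simp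
      then show ?thesis using k by (simp add: k_def)
    qed
  qed
  then show ?thesis
    using L(1) by (intro exI[of _ L]) (auto simp: disc_body_def)
qed

text \<open>The two directions of the comparison with the Taylor polynomial, with K and L fixed
  before the point and the line. In the second, membership in the body bounds r on
  \<open>{0..s}\<close> along every rotation w; after the remainder is moved across, the polynomial
  is bounded on that interval and so are its scaled coefficients.\<close>

lemma disc_body_jet_bound:
  "\<exists>K>0. \<exists>L>0. \<forall>p\<in>bdry r. \<forall>u. norm u = 1 \<longrightarrow>
    (\<forall>w t. cmod w = 1 \<longrightarrow> 0 \<le> t \<longrightarrow> t \<le> 1 \<longrightarrow>
       \<bar>r (p + t *\<^sub>R (w *s u))\<bar> \<le> (\<Sum>j\<le>M. \<bar>dirder j r (w *s u) p / fact j\<bar> * t ^ j) + L * t ^ Suc M) \<and>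
    (\<forall>w s \<epsilon>. cmod w = 1 \<longrightarrow> 0 \<le> s \<longrightarrow> s \<le> 1 \<longrightarrow> s *\<^sub>R u \<in> disc_body r p \<epsilon> \<longrightarrow>
       (\<Sum>j\<le>M. \<bar>dirder j r (w *s u) p / fact j\<bar> * s ^ j) \<le> K * (\<epsilon> + L * s ^ Suc M))"
proof -
  obtain R where R: "\<And>p. p \<in> bdry r \<Longrightarrow> norm p + 1 \<le> R"
    using bdry_norm_bound by blast
  obtain L where L: "L \<ge> 1" "\<And>x v. norm x \<le> R \<Longrightarrow> norm v = 1 \<Longrightarrow> \<bar>dirder (Suc M) r v x\<bar> \<le> L"
    using dirder_bounded[OF smooth_r, of "Suc M" R] by blast
  obtain K where K: "K > 0" "\<And>(a :: nat \<Rightarrow> real) s e. 0 \<le> s \<Longrightarrow>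
      \<forall>t\<in>{0..s}. \<bar>\<Sum>j\<le>M. a j * t ^ j\<bar> \<le> e \<Longrightarrow> (\<Sum>j\<le>M. \<bar>a j\<bar> * s ^ j) \<le> K * e"
    using sum_abs_coeff_le[of M] by blast
  have main: "\<bar>r (p + t *\<^sub>R (w *s u))\<bar> \<le> (\<Sum>j\<le>M. \<bar>dirder j r (w *s u) p / fact j\<bar> * t ^ j) + L * t ^ Suc M"
      "s *\<^sub>R u \<in> disc_body r p \<epsilon> \<Longrightarrow> t \<le> s \<Longrightarrow> s \<le> 1 \<Longrightarrow>
       \<bar>\<Sum>j\<le>M. dirder j r (w *s u) p / fact j * t ^ j\<bar> \<le> \<epsilon> + L * s ^ Suc M"
    if p: "p \<in> bdry r" and u: "norm u = 1" and w: "cmod w = 1" and t: "0 \<le> t" "t \<le> 1" for p u w t s \<epsilon>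
  proof -
    let ?P = "\<Sum>j\<le>M. dirder j r (w *s u) p / fact j * t ^ j"
    have 1: "\<bar>r (p + t *\<^sub>R (w *s u)) - ?P\<bar> \<le> L * t ^ Suc M"
      using Maclaurin_remainder_bound[OF smooth_r _ t R[OF p] L(2), of "w *s u"] u w
      by (simp add: norm_vector_smult lessThan_Suc_atMost)
    have "\<bar>?P\<bar> \<le> (\<Sum>j\<le>M. \<bar>dirder j r (w *s u) p / fact j * t ^ j\<bar>)"
      by (rule sum_abs)
    also have "\<dots> = (\<Sum>j\<le>M. \<bar>dirder j r (w *s u) p / fact j\<bar> * t ^ j)"
      using t by (simp add: abs_mult)
    finally show "\<bar>r (p + t *\<^sub>R (w *s u))\<bar> \<le> (\<Sum>j\<le>M. \<bar>dirder j r (w *s u) p / fact j\<bar> * t ^ j) + L * t ^ Suc M"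
      using 1 by linarith
    assume s: "s *\<^sub>R u \<in> disc_body r p \<epsilon>" "t \<le> s" "s \<le> 1"
    have "\<bar>r (p + t *\<^sub>R (w *s u))\<bar> \<le> \<epsilon>"
    proof (cases "s = 0")
      case True
      then show ?thesis
        using s t disc_body_abs[OF s(1), of 0] by (simp add: bdry_eq_0[OF smooth_r p])
    next
      case False
      have "t *\<^sub>R (w *s u) = (of_real (t / s) * w) *s (s *\<^sub>R u)"
        using False by (simp add: vector_smult_scaleR vector_smult_assoc flip: of_real_vector_smult)
      moreover have "cmod (of_real (t / s) * w) \<le> 1"
        unfolding norm_mult norm_of_real using w s t False by simp
      ultimately show ?thesis
        using disc_body_abs[OF s(1), of "of_real (t / s) * w"] by (simp add: bdry_eq_0[OF smooth_r p])
    qed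
    moreover have "L * t ^ Suc M \<le> L * s ^ Suc M"
      using L s t by (intro mult_left_mono power_mono) auto
    ultimately show "\<bar>?P\<bar> \<le> \<epsilon> + L * s ^ Suc M"
      using 1 by linarith
  qed
  show ?thesis
  proof (rule exI[of _ K], intro conjI exI[of _ L] ballI allI impI)
    fix p :: "complex^'n" and u w s \<epsilon>
    assume *: "p \<in> bdry r" "norm u = 1" "cmod w = 1" "0 \<le> s" "s \<le> 1" "s *\<^sub>R u \<in> disc_body r p \<epsilon>"
    show "(\<Sum>j\<le>M. \<bar>dirder j r (w *s u) p / fact j\<bar> * s ^ j) \<le> K * (\<epsilon> + L * s ^ Suc M)"
      using * by (intro K(2) ballI main(2)) auto
  qed (use main(1) K L in auto)
qed

text \<open>This is the scaling that convexity does not supply. Dilating by B multiplies each Taylor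
  term by at most a power of B, so it suffices that the coefficients and the remainder are of size
  \<epsilon> at the original length.\<close>

lemma disc_body_doubling:
  assumes B: "B \<ge> 1"
  shows "\<exists>C>1. \<exists>\<epsilon>0>0. \<forall>p\<in>bdry r. \<forall>\<epsilon>\<in>{0<..<\<epsilon>0}. \<forall>h\<in>disc_body r p \<epsilon>.
    B *\<^sub>R h \<in> disc_body r p (C * \<epsilon>)"
proof -
  obtain M c where c: "c > 0" and jet: "\<And>p u. p \<in> bdry r \<Longrightarrow> norm u = 1 \<Longrightarrow>
     \<exists>w. cmod w = 1 \<and> c \<le> (\<Sum>j\<le>M. \<bar>dirder j r (w *s u) p / fact j\<bar>)"
    using jet_lower_bound by blast
  obtain K L where KL: "K > 0" "L > 0"
    and upper: "\<And>p u w t. p \<in> bdry r \<Longrightarrow> norm u = 1 \<Longrightarrow> cmod w = 1 \<Longrightarrow> 0 \<le> t \<Longrightarrow> t \<le> 1 \<Longrightarrow>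
       \<bar>r (p + t *\<^sub>R (w *s u))\<bar> \<le> (\<Sum>j\<le>M. \<bar>dirder j r (w *s u) p / fact j\<bar> * t ^ j) + L * t ^ Suc M"
    and coeff: "\<And>p u w s \<epsilon>. p \<in> bdry r \<Longrightarrow> norm u = 1 \<Longrightarrow> cmod w = 1 \<Longrightarrow> 0 \<le> s \<Longrightarrow> s \<le> 1 \<Longrightarrow>
       s *\<^sub>R u \<in> disc_body r p \<epsilon> \<Longrightarrow>
       (\<Sum>j\<le>M. \<bar>dirder j r (w *s u) p / fact j\<bar> * s ^ j) \<le> K * (\<epsilon> + L * s ^ Suc M)"
    using disc_body_jet_bound[of M] by (elim exE conjE) (erule that; blast)
  \<comment> \<open>For s up to s0 the remainder term \<open>K * L * s * s ^ M\<close> is at most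
    half of \<open>c * s ^ M\<close> and can be absorbed into the left side of the lower
    bound.\<close>
  define s0 where "s0 = min 1 (c / (2 * K * L))"
  have s0: "0 < s0" "s0 \<le> 1" "K * L * s0 \<le> c / 2"
    using c KL by (auto simp: s0_def min_def field_simps)
  have lower: "s ^ M \<le> 2 * K / c * \<epsilon>"
    if p: "p \<in> bdry r" and u: "norm u = 1" and s: "0 < s" "s \<le> s0" "s *\<^sub>R u \<in> disc_body r p \<epsilon>" for p u s \<epsilon>
  proof -
    obtain w where w: "cmod w = 1" "c \<le> (\<Sum>j\<le>M. \<bar>dirder j r (w *s u) p / fact j\<bar>)"
      using jet[OF p u] by blast
    have "c * s ^ M \<le> (\<Sum>j\<le>M. \<bar>dirder j r (w *s u) p / fact j\<bar>) * s ^ M"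
      using w s by (intro mult_right_mono) auto
    also have "\<dots> \<le> (\<Sum>j\<le>M. \<bar>dirder j r (w *s u) p / fact j\<bar> * s ^ j)"
      unfolding sum_distrib_right using s s0
      by (intro sum_mono mult_left_mono power_decreasing) auto
    also have "\<dots> \<le> K * (\<epsilon> + L * s ^ Suc M)"
      using p u w s s0 by (intro coeff) auto
    also have "\<dots> = K * \<epsilon> + (K * L * s) * s ^ M"
      by (simp add: algebra_simps)
    also have "\<dots> \<le> K * \<epsilon> + c / 2 * s ^ M"
    proof (intro add_left_mono mult_right_mono)
      have "K * L * s \<le> K * L * s0" using s KL by (intro mult_left_mono) auto
      then show "K * L * s \<le> c / 2" using s0 by linarith
    qed (use s in auto)
    finally show ?thesis using c by (simp add: field_simps)
  qed
  \<comment> \<open>A vector of length below s1 keeps length below s0, hence below 1, after dilation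
    by B, so Taylor's bound still applies.\<close>
  define s1 where "s1 = s0 / B"
  have s1: "0 < s1" "s1 \<le> s0" "B * s1 = s0"
    using s0 B by (auto simp: s1_def field_simps)
  \<comment> \<open>The value at which the bound \<open>s ^ M \<le> 2 * K / c * \<epsilon>\<close>
    would just permit s = s1.\<close>
  define \<epsilon>0 where "\<epsilon>0 = c / (2 * K) * s1 ^ M"
  \<comment> \<open>The bracket collects the coefficient bound K \<epsilon> and the remainders, with
    \<open>s ^ Suc M\<close> replaced by \<open>2 * K / c * \<epsilon>\<close>; the summand 2
    guarantees C > 1.\<close>
  define C where "C = B ^ Suc M * (K + (K + 1) * L * (2 * K / c)) + 2"
  have "0 \<le> B ^ Suc M * (K + (K + 1) * L * (2 * K / c))"
    using B KL c by simp
  then have "C > 1" by (simp add: C_def)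
  have "B *\<^sub>R h \<in> disc_body r p (C * \<epsilon>)"
    if p: "p \<in> bdry r" and \<epsilon>: "0 < \<epsilon>" "\<epsilon> < \<epsilon>0" and h: "h \<in> disc_body r p \<epsilon>" for p \<epsilon> h
  proof (cases "h = 0")
    case True
    then show ?thesis using \<epsilon> \<open>C > 1\<close> by (simp add: disc_body_def)
  next
    case False
    define s u where "s = norm h" and "u = h /\<^sub>R s"
    have s: "s > 0" and u: "norm u = 1" and h_eq: "h = s *\<^sub>R u"
      using False by (auto simp: s_def u_def)
    have "s < s1"
    proof (rule ccontr)
      \<comment> \<open>A longer vector could be shrunk to length exactly s1, where the lower bound
        is valid and contradicts the choice of \<epsilon>0.\<close>
      assume "\<not> s < s1"
      then have "(s1 / s) *\<^sub>R h \<in> disc_body r p \<epsilon>"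
        using s s1 by (intro disc_body_scaleR[OF h]) auto
      then have "s1 *\<^sub>R u \<in> disc_body r p \<epsilon>"
        using s by (simp add: h_eq)
      then have "s1 ^ M \<le> 2 * K / c * \<epsilon>"
        using p u s1 by (intro lower) auto
      also have "\<dots> < 2 * K / c * \<epsilon>0"
        using \<epsilon> KL c by (intro mult_strict_left_mono) auto
      also have "\<dots> = s1 ^ M"
        using KL c by (simp add: \<epsilon>0_def)
      finally show False by simp
    qed
    have "s ^ M \<le> 2 * K / c * \<epsilon>"
      using \<open>s < s1\<close> s1 p u s h by (intro lower) (auto simp: h_eq)
    moreover have "s ^ Suc M \<le> s ^ M"
      using s \<open>s < s1\<close> s1 s0 by (intro power_decreasing) auto
    \<comment> \<open>The lower bound came from one favourable rotation, but it constrains the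
      length alone, so it controls remainders in all rotations.\<close>
    ultimately have sM: "s ^ Suc M \<le> 2 * K / c * \<epsilon>" by linarith
    have "r (p + l *s (B *\<^sub>R h)) - r p \<le> C * \<epsilon>" if l: "cmod l \<le> 1" for l
    proof -
      define w where "w = (if l = 0 then 1 else sgn l)"
      define t where "t = cmod l * B * s"
      have w: "cmod w = 1" by (simp add: w_def norm_sgn)
      have lw: "l = of_real (cmod l) * w" by (simp add: w_def sgn_eq)
      have "l *s (B *\<^sub>R h) = (l * of_real (B * s)) *s u"
        by (simp add: h_eq vector_smult_scaleR)
      also have "l * of_real (B * s) = of_real t * w"
        by (subst lw) (simp add: t_def)
      also have "(of_real t * w) *s u = t *\<^sub>R (w *s u)"
        by (simp add: vector_smult_assoc flip: of_real_vector_smult)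
      finally have eq: "l *s (B *\<^sub>R h) = t *\<^sub>R (w *s u)" .
      have tB: "t \<le> B * s" and t0: "0 \<le> t"
        using l B s by (simp_all add: t_def mult_left_le_one_le mult.assoc)
      have "B * s \<le> B * s1" using \<open>s < s1\<close> B by (intro mult_left_mono) auto
      then have t1: "t \<le> 1" using tB s1 s0 by linarith
      \<comment> \<open>As B is at least 1, its highest power serves all degrees and factors out of
        the sum.\<close>
      have pow: "t ^ j \<le> B ^ Suc M * s ^ j" if "j \<le> Suc M" for j
      proof -
        have "t ^ j \<le> (B * s) ^ j" using tB t0 by (rule power_mono)
        also have "\<dots> \<le> B ^ Suc M * s ^ j"
          unfolding power_mult_distrib using that B s by (intro mult_right_mono power_increasing) auto
        finally show ?thesis .
      qed
      let ?\<Sigma> = "\<lambda>t. \<Sum>j\<le>M. \<bar>dirder j r (w *s u) p / fact j\<bar> * t ^ j"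
      have "r (p + t *\<^sub>R (w *s u)) \<le> ?\<Sigma> t + L * t ^ Suc M"
        using upper[OF p u w t0 t1] by linarith
      also have "\<dots> \<le> B ^ Suc M * ?\<Sigma> s + L * (B ^ Suc M * s ^ Suc M)"
      proof (rule add_mono)
        have "?\<Sigma> t \<le> (\<Sum>j\<le>M. \<bar>dirder j r (w *s u) p / fact j\<bar> * (B ^ Suc M * s ^ j))"
          using pow by (intro sum_mono mult_left_mono) auto
        then show "?\<Sigma> t \<le> B ^ Suc M * ?\<Sigma> s"
          by (simp only: sum_distrib_left mult.left_commute)
      qed (use pow[of "Suc M"] KL in \<open>auto intro: mult_left_mono\<close>)
      also have "\<dots> = B ^ Suc M * (?\<Sigma> s + L * s ^ Suc M)"
        by (simp only: distrib_left mult.left_commute)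
      also have "\<dots> \<le> B ^ Suc M * (K * (\<epsilon> + L * s ^ Suc M) + L * s ^ Suc M)"
        using p u w s s0 s1 \<open>s < s1\<close> h B
        by (intro mult_left_mono add_right_mono coeff) (auto simp: h_eq)
      also have "\<dots> = B ^ Suc M * (K * \<epsilon> + (K + 1) * L * s ^ Suc M)"
        by (simp only: distrib_left distrib_right mult.assoc mult_1_left add.assoc)
      also have "\<dots> \<le> B ^ Suc M * (K * \<epsilon> + (K + 1) * L * (2 * K / c * \<epsilon>))"
        using sM B KL by (intro mult_left_mono add_left_mono) auto
      also have "\<dots> = (C - 2) * \<epsilon>"
        unfolding C_def by (simp only: distrib_left distrib_right mult.assoc add_diff_cancel_right')
      also have "\<dots> \<le> C * \<epsilon>" using \<epsilon> by (simp add: left_diff_distrib)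
      finally show ?thesis
        by (simp add: eq bdry_eq_0[OF smooth_r p])
    qed
    then show ?thesis by (simp add: disc_body_def)
  qed
  moreover have "\<epsilon>0 > 0" using c KL s1 by (simp add: \<epsilon>0_def)
  ultimately show ?thesis
    using \<open>C > 1\<close> by (intro exI[of _ C] conjI exI[of _ \<epsilon>0]) auto
qed

text \<open>With T = N + K L, the vector \<open>q - \<xi>\<close> divided by T is a convex
  combination of \<open>p - \<xi>\<close> divided by N and \<open>q - p\<close> divided by K L, both
  in the body at scale \<epsilon>. Doubling with factor A T cancels the division and supplies the
  extra factor A that is needed to enter the polydisc at the new scale.\<close>

lemma polydisc_engulfing:
  assumes K: "K > 0"
  shows "\<exists>C>1. \<exists>\<epsilon>0>0. \<forall>\<xi>\<in>bdry r. \<forall>\<epsilon>\<in>{0<..<\<epsilon>0}. \<forall>p\<in>polydisc r \<epsilon> \<xi>. \<forall>q.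
    dist p q \<le> K * \<epsilon> \<longrightarrow> q \<in> polydisc r (C * \<epsilon>) \<xi>"
proof -
  obtain L where L: "L \<ge> 1"
    "\<And>p \<epsilon>. p \<in> bdry r \<Longrightarrow> 0 < \<epsilon> \<Longrightarrow> \<epsilon> \<le> 1 \<Longrightarrow> cball 0 (\<epsilon> / L) \<subseteq> disc_body r p \<epsilon>"
    using disc_body_lipschitz_ball by (metis greaterThanAtMost_iff)
  define N where "N = real CARD('n)"
  define A where "A = (1 + L) * 2 ^ CARD('n)"
  have N: "N \<ge> 1" by (simp add: N_def Suc_leI)
  have "A \<ge> 1 * 1" unfolding A_def using L(1) by (intro mult_mono) auto
  moreover have "N + K * L \<ge> 1" using N K L(1) by (simp add: add_increasing2)
  ultimately have "A * (N + K * L) \<ge> 1 * 1" by (intro mult_mono) auto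
  then obtain C \<epsilon>1 where C: "C > 1" "\<epsilon>1 > 0" and doubling: "\<And>p \<epsilon> h. p \<in> bdry r \<Longrightarrow> 0 < \<epsilon> \<Longrightarrow> \<epsilon> < \<epsilon>1 \<Longrightarrow>
      h \<in> disc_body r p \<epsilon> \<Longrightarrow> (A * (N + K * L)) *\<^sub>R h \<in> disc_body r p (C * \<epsilon>)"
    using disc_body_doubling[of "A * (N + K * L)"] by (metis greaterThanLessThan_iff mult_1)
  \<comment> \<open>The bound 1 / C keeps the enlarged scale at most 1, where the uniform ball in
    the body is available.\<close>
  have "q \<in> polydisc r (C * \<epsilon>) \<xi>"
    if \<xi>: "\<xi> \<in> bdry r" and \<epsilon>: "0 < \<epsilon>" "\<epsilon> < min \<epsilon>1 (1 / C)"
      and p: "p \<in> polydisc r \<epsilon> \<xi>" and q: "dist p q \<le> K * \<epsilon>" for \<xi> \<epsilon> p q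
  proof -
    have C\<epsilon>: "0 < C * \<epsilon>" "C * \<epsilon> \<le> 1" using \<epsilon> C by (auto simp: field_simps)
    have "\<epsilon> \<le> C * \<epsilon>" using C \<epsilon> by simp
    then have "\<epsilon> \<le> 1" using C\<epsilon> by linarith
    let ?S = "disc_body r \<xi> \<epsilon>" and ?T = "N + K * L"
    have T: "?T > 0" using N K L(1) by (simp add: add_pos_pos)
    have "grad r \<xi> \<noteq> 0" using norm_grad_bdry[OF \<xi>] by auto
    then have 1: "(1 / N) *\<^sub>R (p - \<xi>) \<in> ?S"
      unfolding N_def using polydisc_imp_disc_body[OF \<epsilon>(1) _ p] by simp
    have "norm ((1 / (K * L)) *\<^sub>R (q - p)) \<le> \<epsilon> / L"
      unfolding norm_scaleR using q K L(1)
      by (simp add: dist_norm norm_minus_commute[of q] field_simps)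
    then have 2: "(1 / (K * L)) *\<^sub>R (q - p) \<in> ?S"
      using L(2)[OF \<xi> \<epsilon>(1) \<open>\<epsilon> \<le> 1\<close>] by (auto simp: subset_iff)
    have "(N / ?T) *\<^sub>R (1 / N) *\<^sub>R (p - \<xi>) + (K * L / ?T) *\<^sub>R (1 / (K * L)) *\<^sub>R (q - p) \<in> ?S"
      using N K L(1) T by (intro convexD[OF convex_disc_body 1 2]) (auto simp flip: add_divide_distrib)
    moreover have "(N / ?T) *\<^sub>R (1 / N) *\<^sub>R (p - \<xi>) + (K * L / ?T) *\<^sub>R (1 / (K * L)) *\<^sub>R (q - p)
        = (1 / ?T) *\<^sub>R (q - \<xi>)"
      using N K L(1) by (simp flip: scaleR_right_distrib)
    ultimately have "(1 / ?T) *\<^sub>R (q - \<xi>) \<in> ?S" by simp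
    from doubling[OF \<xi> \<epsilon>(1) _ this] have "A *\<^sub>R (q - \<xi>) \<in> disc_body r \<xi> (C * \<epsilon>)"
      using T \<epsilon> by simp
    then have "\<xi> + (q - \<xi>) \<in> polydisc r (C * \<epsilon>) \<xi>"
      unfolding A_def by (intro disc_body_imp_polydisc[OF C\<epsilon>(1) norm_grad_bdry[OF \<xi>] L(1) L(2)[OF \<xi> C\<epsilon>]])
    then show ?thesis by simp
  qed
  moreover have "min \<epsilon>1 (1 / C) > 0" using C by simp
  ultimately show ?thesis
    using C(1) by (intro exI[of _ C] conjI exI[of _ "min \<epsilon>1 (1 / C)"]) auto
qed

text \<open>The part of the closure outside V is compact and avoids the boundary, so r has a
  negative maximum on it. This puts points of the projection tent, known only to lie in U, into the
  domain of the flow.\<close>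

lemma sublevel_in_nbhd:
  assumes "open V" "bdry r \<subseteq> V"
  shows "\<exists>t>0. \<forall>z\<in>Omega r. - t < r z \<longrightarrow> z \<in> V"
proof (cases "closure (Omega r) - V = {}")
  case True
  then show ?thesis using closure_subset[of "Omega r"] by (intro exI[of _ 1]) auto
next
  case False
  have "compact (closure (Omega r))"
    using adm by (simp add: admissible_defining_function_def)
  then have "compact (closure (Omega r) - V)"
    using assms(1) by (rule compact_diff)
  moreover have "continuous_on (closure (Omega r) - V) r"
    by (rule smooth_fun_continuous[OF smooth_r])
  ultimately obtain x where x: "x \<in> closure (Omega r) - V"
    "\<And>y. y \<in> closure (Omega r) - V \<Longrightarrow> r y \<le> r x"
    using continuous_attains_sup[OF _ False] by blast
  have "x \<in> Omega r"
    using x(1) assms(2) by (auto simp: bdry_def frontier_def dest: interior_subset[THEN subsetD])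
  then have "r x < 0" by (simp add: Omega_def)
  then show ?thesis
    using x(2) closure_subset[of "Omega r"] by (intro exI[of _ "- r x"]) force
qed

end

section \<open>Comparison of the projections\<close>

lemma proj_props:
  assumes "admissible_nbhd r U" "z \<in> Omega r \<inter> U"
  shows "proj r z \<in> bdry r" "dist z (proj r z) = infdist z (bdry r)"
proof -
  have "\<exists>!p. p \<in> bdry r \<and> dist z p = infdist z (bdry r)"
    using assms by (simp add: admissible_nbhd_def)
  from theI'[OF this] show "proj r z \<in> bdry r" "dist z (proj r z) = infdist z (bdry r)"
    by (simp_all add: proj_def)
qed

text \<open>Bijectivity onto the level set makes the definite description meaningful. The flow field
  has norm \<open>1 / norm (grad r x)\<close> at x, so the speed bound 3/2 comes from the lower
  gradient bound 2/3, and the mean value inequality over time \<open>- r z\<close> gives the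
  distance.\<close>

lemma flowproj_props:
  assumes nbhd: "admissible_nbhd r U" and flow: "admissible_flow r U V t0 \<phi>"
    and z: "- t0 < r z" "r z < 0"
  shows "flowproj r \<phi> z \<in> bdry r" "dist z (flowproj r \<phi> z) \<le> 3/2 * - r z"
proof -
  let ?t = "- r z" and ?p = "flowproj r \<phi> z"
  have t: "?t \<in> {0..<t0}" using z by simp
  then have "bij_betw (\<lambda>x. \<phi> (x, ?t)) (bdry r) {y. r y = - ?t}"
    using flow by (simp only: admissible_flow_def)
  then have inj: "inj_on (\<lambda>x. \<phi> (x, ?t)) (bdry r)" and "z \<in> (\<lambda>x. \<phi> (x, ?t)) ` bdry r"
    by (simp_all add: bij_betw_def)
  then have "\<exists>!p. p \<in> bdry r \<and> \<phi> (p, ?t) = z"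
    by (auto intro: inj_onD[OF inj])
  from theI'[OF this] have p: "?p \<in> bdry r" and pz: "\<phi> (?p, ?t) = z"
    by (simp_all add: flowproj_def)
  show "?p \<in> bdry r" by (rule p)
  have V: "?p \<in> V" using p flow by (auto simp: admissible_flow_def)
  define F where "F s = - (1 / (norm (grad r (\<phi> (?p, s))))\<^sup>2) *\<^sub>R grad r (\<phi> (?p, s))" for s
  have "norm (\<phi> (?p, ?t) - \<phi> (?p, 0)) \<le> 3/2 * norm (?t - 0)"
  proof (rule differentiable_bound)
    show "convex {0..<t0}" by (rule convex_real_interval)
    fix s assume s: "s \<in> {0..<t0}"
    show "((\<lambda>s. \<phi> (?p, s)) has_derivative (\<lambda>h. h *\<^sub>R F s)) (at s within {0..<t0})"
      using flow V s unfolding admissible_flow_def has_vector_derivative_def F_def by blast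
    have "\<phi> (?p, s) \<in> U" using flow V s unfolding admissible_flow_def by blast
    then have g: "2/3 \<le> norm (grad r (\<phi> (?p, s)))"
      using nbhd by (simp add: admissible_nbhd_def)
    have "norm (F s) = 1 / norm (grad r (\<phi> (?p, s)))"
      using g by (simp add: F_def power2_eq_square)
    also have "\<dots> \<le> 3/2" using g by (simp add: divide_le_eq)
    finally have "norm (F s) \<le> 3/2" .
    then show "onorm (\<lambda>h. h *\<^sub>R F s) \<le> 3/2"
      using mult_left_mono[of "norm (F s)" "3/2"] by (intro onorm_le) (simp add: mult.commute)
  qed (use t in auto)
  moreover have "\<phi> (?p, 0) = ?p" using flow V by (simp add: admissible_flow_def)
  ultimately show "dist z ?p \<le> 3/2 * - r z"
    using z by (simp add: pz dist_norm)
qed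

text \<open>The nearest boundary point is no further from z than the flow point, so the triangle
  inequality doubles 3/2.\<close>

lemma dist_flowproj_proj:
  assumes nbhd: "admissible_nbhd r U" and flow: "admissible_flow r U V t0 \<phi>"
    and z: "z \<in> Omega r \<inter> U" "- t0 < r z" "r z < 0"
  shows "dist (flowproj r \<phi> z) (proj r z) \<le> 3 * - r z"
proof -
  note fl = flowproj_props[OF nbhd flow z(2,3)]
  have "dist z (proj r z) \<le> dist z (flowproj r \<phi> z)"
    using proj_props(2)[OF nbhd z(1)] infdist_le[OF fl(1), of z] by simp
  then show ?thesis
    using fl(2) dist_triangle2[of "flowproj r \<phi> z" "proj r z" z] by (simp add: dist_commute)
qed

theorem mainTheorem3:
  fixes r :: "complex^'n \<Rightarrow> real"
    and U V :: "(complex^'n) set" and t0 :: real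
    and \<phi> :: "(complex^'n) \<times> real \<Rightarrow> complex^'n"
  assumes "admissible_defining_function r"
    and "admissible_nbhd r U"
    and "admissible_flow r U V t0 \<phi>"
  shows "\<exists>C1 \<tau>2. C1 > 1 \<and> \<tau>2 > 0 \<and>
     (\<forall>\<epsilon> \<zeta>. 0 < \<epsilon> \<and> \<epsilon> < \<tau>2 \<and> \<zeta> \<in> bdry r \<longrightarrow>
        tent_flow r V \<phi> \<epsilon> \<zeta> \<subseteq> tent r U (C1 * \<epsilon>) \<zeta> \<and>
        tent r U \<epsilon> \<zeta> \<subseteq> tent_flow r V \<phi> (C1 * \<epsilon>) \<zeta>) \<and>
     (\<forall>D c Cf \<delta>. dyadic_system r D c Cf \<delta> \<longrightarrow>
        (\<forall>k. \<forall>Q\<in>D k. \<delta> ^ k \<le> \<tau>2 / Cf \<longrightarrow>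
           tent_d_proj r U Q (\<delta> ^ k) \<subseteq> tent_flow r V \<phi> (Cf * C1 * \<delta> ^ k) (c Q) \<and>
           tent_d_flow r V \<phi> Q (\<delta> ^ k) \<subseteq> tent r U (Cf * C1 * \<delta> ^ k) (c Q)))"
proof -
  have V: "open V" "bdry r \<subseteq> V" "V \<subseteq> U" "t0 > 0"
    using assms(3) by (simp_all add: admissible_flow_def)
  obtain C \<epsilon>0 where C: "C > 1" "\<epsilon>0 > 0" and engulf: "\<And>\<xi> \<epsilon> p q. \<xi> \<in> bdry r \<Longrightarrow> 0 < \<epsilon> \<Longrightarrow> \<epsilon> < \<epsilon>0 \<Longrightarrow>
      p \<in> polydisc r \<epsilon> \<xi> \<Longrightarrow> dist p q \<le> 3 * \<epsilon> \<Longrightarrow> q \<in> polydisc r (C * \<epsilon>) \<xi>"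
    using polydisc_engulfing[OF assms(1), of 3] by (metis greaterThanLessThan_iff zero_less_numeral)
  obtain t1 where t1: "t1 > 0" "\<And>z. z \<in> Omega r \<Longrightarrow> - t1 < r z \<Longrightarrow> z \<in> V"
    using sublevel_in_nbhd[OF assms(1) V(1,2)] by blast
  \<comment> \<open>Below \<epsilon>0 engulfing holds, below t0 the flow projection is defined, and
    below t1 the points lie in V.\<close>
  define \<tau> where "\<tau> = min \<epsilon>0 (min t0 t1)"
  have \<tau>: "\<tau> > 0" using C V t1 by (simp add: \<tau>_def)
  have incl: "tent_flow r V \<phi> \<epsilon> \<zeta> \<subseteq> tent r U (C * \<epsilon>) \<zeta>" "tent r U \<epsilon> \<zeta> \<subseteq> tent_flow r V \<phi> (C * \<epsilon>) \<zeta>"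
    if \<epsilon>: "0 < \<epsilon>" "\<epsilon> < \<tau>" and \<zeta>: "\<zeta> \<in> bdry r" for \<epsilon> \<zeta>
  proof -
    have le: "\<epsilon> \<le> C * \<epsilon>" using C \<epsilon> by simp
    have \<epsilon>': "\<epsilon> < \<epsilon>0" "\<epsilon> < t0" "\<epsilon> < t1" using \<epsilon> by (simp_all add: \<tau>_def)
    show "tent_flow r V \<phi> \<epsilon> \<zeta> \<subseteq> tent r U (C * \<epsilon>) \<zeta>"
    proof
      fix z assume "z \<in> tent_flow r V \<phi> \<epsilon> \<zeta>"
      then have z: "z \<in> Omega r \<inter> U" "flowproj r \<phi> z \<in> polydisc r \<epsilon> \<zeta>" "- \<epsilon> < r z" "r z < 0"
        using V by (auto simp: tent_flow_def)
      have "dist (flowproj r \<phi> z) (proj r z) \<le> 3 * - r z"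
        using z \<epsilon>' by (intro dist_flowproj_proj[OF assms(2,3)]) auto
      then have "proj r z \<in> polydisc r (C * \<epsilon>) \<zeta>"
        using z \<epsilon> \<epsilon>' by (intro engulf[OF \<zeta> _ _ z(2)]) auto
      moreover have gt: "- (C * \<epsilon>) < r z" using le z by linarith
      ultimately show "z \<in> tent r U (C * \<epsilon>) \<zeta>"
        using z gt proj_props(1)[OF assms(2) z(1)] by (auto simp: tent_def)
    qed
    show "tent r U \<epsilon> \<zeta> \<subseteq> tent_flow r V \<phi> (C * \<epsilon>) \<zeta>"
    proof
      fix z assume "z \<in> tent r U \<epsilon> \<zeta>"
      then have z: "z \<in> Omega r \<inter> U" "proj r z \<in> polydisc r \<epsilon> \<zeta>" "- \<epsilon> < r z" "r z < 0"
        by (auto simp: tent_def)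
      have zV: "z \<in> V" using z \<epsilon>' by (intro t1(2)) auto
      have t0: "- t0 < r z" using z \<epsilon>' by simp
      have "dist (flowproj r \<phi> z) (proj r z) \<le> 3 * - r z"
        by (rule dist_flowproj_proj[OF assms(2,3) z(1) t0 z(4)])
      then have "flowproj r \<phi> z \<in> polydisc r (C * \<epsilon>) \<zeta>"
        using z \<epsilon> \<epsilon>' by (intro engulf[OF \<zeta> _ _ z(2)]) (auto simp: dist_commute)
      moreover have gt: "- (C * \<epsilon>) < r z" using le z by linarith
      ultimately show "z \<in> tent_flow r V \<phi> (C * \<epsilon>) \<zeta>"
        using z gt zV flowproj_props(1)[OF assms(2,3) t0 z(4)] by (auto simp: tent_flow_def)
    qed
  qed
  \<comment> \<open>The dyadic hypothesis is non-strict while the inclusions of tents need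
    \<epsilon> strictly below \<tau>; hence the final threshold is half of \<tau>.\<close>
  have dyadic: "tent_d_proj r U Q (\<delta> ^ k) \<subseteq> tent_flow r V \<phi> (Cf * C * \<delta> ^ k) (c Q) \<and>
      tent_d_flow r V \<phi> Q (\<delta> ^ k) \<subseteq> tent r U (Cf * C * \<delta> ^ k) (c Q)"
    if D: "dyadic_system r D c Cf \<delta>" and Q: "Q \<in> D k" and small: "\<delta> ^ k \<le> \<tau> / 2 / Cf" for D c Cf \<delta> k Q
  proof -
    define \<epsilon> where "\<epsilon> = Cf * \<delta> ^ k"
    have Cf: "Cf > 1" and \<delta>: "0 < \<delta> ^ k" using D by (auto simp: dyadic_system_def)
    have c: "c Q \<in> bdry r" "Q \<subseteq> MSball r (c Q) \<epsilon>"
      using D Q by (auto simp: dyadic_system_def \<epsilon>_def)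
    have le: "\<delta> ^ k \<le> \<epsilon>" using Cf \<delta> by (simp add: \<epsilon>_def)
    have "\<epsilon> \<le> \<tau> / 2" using small Cf by (simp add: \<epsilon>_def field_simps)
    then have \<epsilon>: "0 < \<epsilon>" "\<epsilon> < \<tau>" using le \<delta> \<tau> by simp_all
    \<comment> \<open>A dyadic tent sits in the tent over the ball containing Q: its base is
      smaller, and its height \<open>\<delta> ^ k\<close> is at most \<epsilon> because Cf >
      1.\<close>
    have "tent_d_proj r U Q (\<delta> ^ k) \<subseteq> tent r U \<epsilon> (c Q)"
      using c le by (force simp: tent_d_proj_def tent_def MSball_def)
    moreover have "tent_d_flow r V \<phi> Q (\<delta> ^ k) \<subseteq> tent_flow r V \<phi> \<epsilon> (c Q)"
      using c le by (force simp: tent_d_flow_def tent_flow_def MSball_def Omega_def)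
    ultimately show ?thesis
      using incl[OF \<epsilon> c(1)] by (simp add: \<epsilon>_def mult_ac) blast
  qed
  show ?thesis
    using C(1) \<tau> incl dyadic by (intro exI[of _ C] exI[of _ "\<tau> / 2"]) auto
qed

end
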